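(* Let $n\ge1$ and $L_1,\dots,L_n\ge1$ be integers, and let the opinion graph $G$ be the lattice with vertex set $$V=\bigg(\prod_{i=1}^n[-L_i,L_i]\bigg)\cap\mathbb{Z}^n,$$ two vertices being joined by an edge if and only if they are at Euclidean distance one. Let $\mathbf{r}=L_1+L_2+\cdots+L_n$ (the radius of $G$). Let the spatial graph $\mathcal{G}=(\mathcal{V},\mathcal{E})$ be any finite connected graph, let $\tau$ be an integer with $\tau\in[\mathbf{r},2\mathbf{r})$, and let $(\zeta_t)$ be the attraction process with confidence threshold $\tau$, started from the uniform product measure, with time to fixation $T$. Then $$P(\zeta_T\equiv\mathrm{cst})\ \ge\ 1-\bigg(\frac{1}{\tau+1-\mathbf{r}}\bigg)\sum_{i=1}^n\frac{L_i(L_i+1)}{2L_i+1}.$$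
   Context: Graphs are simple and undirected. $d(\cdot,\cdot)$ is the geodesic distance on the opinion graph $G=(V,E)$. For $a\neq b$ in $V$, $D(a,b)=\{a'\in V:d(a,a')=1\text{ and }d(a',b)=d(a,b)-1\}$. Let $\vec{\mathcal{E}}$ be the set of directed edges $\vec{xy},\vec{yx}$ for $\{x,y\}\in\mathcal{E}$. The attraction process $(\zeta_t)$ is the continuous-time Markov chain on $V^{\mathcal{V}}$ (an opinion in $V$ at each vertex of $\mathcal{V}$), with right-continuous paths, in which each directed edge $\vec{xy}\in\vec{\mathcal{E}}$ becomes active at rate one, independently over directed edges and independently of $\zeta_0$. When $\vec{xy}$ becomes active and the opinions $a$ at $x$ and $b$ at $y$ satisfy $0<d(a,b)\le\tau$, the opinion at $x$ is replaced by an opinion chosen uniformly at random from $D(a,b)$; otherwise nothing changes. The time to fixation is $T=\inf\{t\ge0:\zeta_t=\zeta_s\text{ for all }s>t\}$ (with $\inf\varnothing=\infty$). The event $\{\zeta_T\equiv\mathrm{cst}\}$ is the event that $T<\infty$ and there is $c\in V$ with $\zeta_T(x)=c$ for all $x\in\mathcal{V}$. The uniform product measure is the initial distribution under which the opinions $\zeta_0(x)$, $x\in\mathcal{V}$, are independent and uniformly distributed on $V$. *)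

theory Defs
  imports "HOL-Probability.Probability"
begin

definition simple_graph :: "'a set \<Rightarrow> 'a set set \<Rightarrow> bool" where
  "simple_graph V E \<longleftrightarrow> E \<subseteq> {{x, y} | x y. x \<in> V \<and> y \<in> V \<and> x \<noteq> y}"

definition dir_edges :: "'a set set \<Rightarrow> ('a \<times> 'a) set" where
  "dir_edges E = {(x, y). {x, y} \<in> E}"

definition connected_graph :: "'a set \<Rightarrow> 'a set set \<Rightarrow> bool" where
  "connected_graph V E \<longleftrightarrow> V \<noteq> {} \<and> (\<forall>x\<in>V. \<forall>y\<in>V. (x, y) \<in> (dir_edges E)\<^sup>*)"

text \<open>Length of a shortest walk; the infimum is \<open>\<infinity>\<close> if there is none.\<close>

definition geo_dist :: "'a set set \<Rightarrow> 'a \<Rightarrow> 'a \<Rightarrow> enat" where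
  "geo_dist E a b = Inf {enat k | k. (a, b) \<in> dir_edges E ^^ k}"

definition closer_nbrs :: "'a set \<Rightarrow> 'a set set \<Rightarrow> 'a \<Rightarrow> 'a \<Rightarrow> 'a set" where
  "closer_nbrs V E a b =
     {a' \<in> V. geo_dist E a a' = 1 \<and> geo_dist E a' b = geo_dist E a b - 1}"

definition lattice_vertices :: "('n::finite \<Rightarrow> nat) \<Rightarrow> (int ^ 'n) set" where
  "lattice_vertices L = {a. \<forall>i. - int (L i) \<le> a $ i \<and> a $ i \<le> int (L i)}"

definition euclid :: "int ^ 'n::finite \<Rightarrow> real ^ 'n" where
  "euclid a = (\<chi> i. real_of_int (a $ i))"

definition lattice_edges :: "('n::finite \<Rightarrow> nat) \<Rightarrow> (int ^ 'n) set set" where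
  "lattice_edges L =
     {{a, b} | a b. a \<in> lattice_vertices L \<and> b \<in> lattice_vertices L \<and>
                    dist (euclid a) (euclid b) = 1}"

definition (in prob_space) poisson_process :: "real \<Rightarrow> (real \<Rightarrow> 'a \<Rightarrow> nat) \<Rightarrow> bool" where
  "poisson_process rate N \<longleftrightarrow>
     (\<forall>t\<ge>0. random_variable (count_space UNIV) (N t)) \<and>
     (\<forall>\<omega>\<in>space M. N 0 \<omega> = 0 \<and> mono_on {0..} (\<lambda>t. N t \<omega>) \<and>
        (\<forall>t\<ge>0. \<forall>\<^sub>F s in at_right t. N s \<omega> = N t \<omega>)) \<and>
     (\<forall>s t. 0 \<le> s \<and> s < t \<longrightarrow>
        distr M (count_space UNIV) (\<lambda>\<omega>. N t \<omega> - N s \<omega>) =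
          measure_pmf (poisson_pmf (rate * (t - s)))) \<and>
     (\<forall>(m::nat) u. 0 \<le> u 0 \<and> strict_mono u \<longrightarrow>
        indep_vars (\<lambda>_. count_space UNIV)
          (\<lambda>i \<omega>. N (u (Suc i)) \<omega> - N (u i) \<omega>) {..<m})"

definition rings :: "(real \<Rightarrow> 'w \<Rightarrow> nat) \<Rightarrow> real \<Rightarrow> 'w \<Rightarrow> bool" where
  "rings N t \<omega> \<longleftrightarrow> 0 < t \<and> (\<forall>s\<in>{0..<t}. N s \<omega> < N t \<omega>)"

text \<open>
  The process is driven by a family of independent sources of randomness: the initial
  configuration, one rate-one Poisson clock \<open>N e\<close> per directed edge \<open>e\<close> of the spatial graph,
  and random choices.  The variable \<open>C e k a b\<close> is uniform on the set of neighbours of \<open>a\<close>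
  closer to \<open>b\<close>; it is the new opinion at \<open>x\<close> if the \<open>k\<close>-th activation of \<open>e = (x, y)\<close> finds
  the opinions \<open>a\<close> at \<open>x\<close> and \<open>b\<close> at \<open>y\<close>, so each of these variables is used at most once.
\<close>

datatype ('v, 'o) source =
    Initial
  | Clock "'v \<times> 'v"
  | Choice "'v \<times> 'v" nat 'o 'o

definition compatible :: "'o set set \<Rightarrow> nat \<Rightarrow> 'o \<Rightarrow> 'o \<Rightarrow> bool" where
  "compatible E \<tau> a b \<longleftrightarrow> 0 < geo_dist E a b \<and> geo_dist E a b \<le> enat \<tau>"

definition sources ::
    "'o set \<Rightarrow> 'o set set \<Rightarrow> 'v set set \<Rightarrow> nat \<Rightarrow> ('v, 'o) source set" where
  "sources V E \<E> \<tau> =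
     {Initial} \<union> Clock ` dir_edges \<E> \<union>
     {Choice e k a b | e k a b. e \<in> dir_edges \<E> \<and> a \<in> V \<and> b \<in> V \<and> compatible E \<tau> a b}"

primrec source_algebra ::
    "'w set \<Rightarrow> ('w \<Rightarrow> 'v \<Rightarrow> 'o) \<Rightarrow> ('v \<times> 'v \<Rightarrow> real \<Rightarrow> 'w \<Rightarrow> nat) \<Rightarrow>
     ('v \<times> 'v \<Rightarrow> nat \<Rightarrow> 'o \<Rightarrow> 'o \<Rightarrow> 'w \<Rightarrow> 'o) \<Rightarrow> ('v, 'o) source \<Rightarrow> 'w set set" where
  "source_algebra \<Omega> \<zeta>0 N C Initial = sigma_sets \<Omega> {\<zeta>0 -` A \<inter> \<Omega> | A. True}"
| "source_algebra \<Omega> \<zeta>0 N C (Clock e) = sigma_sets \<Omega> {N e t -` A \<inter> \<Omega> | t A. 0 \<le> t}"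
| "source_algebra \<Omega> \<zeta>0 N C (Choice e k a b) = sigma_sets \<Omega> {C e k a b -` A \<inter> \<Omega> | A. True}"

text \<open>
  Below, \<open>\<eta>\<close> is the configuration just before time \<open>t\<close>.  Almost surely no two clocks ring
  simultaneously, so the update rule is imposed almost surely only.
\<close>

definition (in prob_space) attraction_process ::
    "'o set \<Rightarrow> 'o set set \<Rightarrow> 'v set \<Rightarrow> 'v set set \<Rightarrow> nat \<Rightarrow>
     (real \<Rightarrow> 'a \<Rightarrow> 'v \<Rightarrow> 'o) \<Rightarrow> bool" where
  "attraction_process V E \<V> \<E> \<tau> \<zeta> \<longleftrightarrow>
     (\<forall>t\<ge>0. random_variable (count_space (\<V> \<rightarrow>\<^sub>E V)) (\<zeta> t)) \<and>
     (\<forall>\<omega>\<in>space M. \<forall>t\<ge>0. \<forall>\<^sub>F s in at_right t. \<zeta> s \<omega> = \<zeta> t \<omega>) \<and>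
     (\<exists>N C.
        (\<forall>e\<in>dir_edges \<E>. poisson_process 1 (N e)) \<and>
        (\<forall>e\<in>dir_edges \<E>. \<forall>k. \<forall>a\<in>V. \<forall>b\<in>V. compatible E \<tau> a b \<longrightarrow>
           random_variable (count_space (closer_nbrs V E a b)) (C e k a b) \<and>
           distr M (count_space (closer_nbrs V E a b)) (C e k a b) =
             uniform_count_measure (closer_nbrs V E a b)) \<and>
        indep_sets (source_algebra (space M) (\<zeta> 0) N C) (sources V E \<E> \<tau>) \<and>
        (AE \<omega> in M. \<forall>t>0. \<exists>\<eta>.
           (\<forall>\<^sub>F s in at_left t. \<zeta> s \<omega> = \<eta>) \<and>
           ((\<forall>e\<in>dir_edges \<E>. \<not> rings (N e) t \<omega>) \<longrightarrow> \<zeta> t \<omega> = \<eta>) \<and>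
           (\<forall>(x, y)\<in>dir_edges \<E>. rings (N (x, y)) t \<omega> \<longrightarrow>
              \<zeta> t \<omega> =
                (if compatible E \<tau> (\<eta> x) (\<eta> y)
                 then \<eta>(x := C (x, y) (N (x, y) t \<omega>) (\<eta> x) (\<eta> y) \<omega>)
                 else \<eta>))))"

definition (in prob_space) uniform_product_initial ::
    "'o set \<Rightarrow> 'v set \<Rightarrow> (real \<Rightarrow> 'a \<Rightarrow> 'v \<Rightarrow> 'o) \<Rightarrow> bool" where
  "uniform_product_initial V \<V> \<zeta> \<longleftrightarrow>
     indep_vars (\<lambda>_. count_space V) (\<lambda>x \<omega>. \<zeta> 0 \<omega> x) \<V> \<and>
     (\<forall>x\<in>\<V>. distr M (count_space V) (\<lambda>\<omega>. \<zeta> 0 \<omega> x) = uniform_count_measure V)"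

definition fixation_time :: "(real \<Rightarrow> 'w \<Rightarrow> 'v \<Rightarrow> 'o) \<Rightarrow> 'w \<Rightarrow> ereal" where
  "fixation_time \<zeta> \<omega> = Inf {ereal t | t. 0 \<le> t \<and> (\<forall>s>t. \<zeta> t \<omega> = \<zeta> s \<omega>)}"

definition fixates_to_constant ::
    "'o set \<Rightarrow> 'v set \<Rightarrow> (real \<Rightarrow> 'w \<Rightarrow> 'v \<Rightarrow> 'o) \<Rightarrow> 'w \<Rightarrow> bool" where
  "fixates_to_constant V \<V> \<zeta> \<omega> \<longleftrightarrow>
     fixation_time \<zeta> \<omega> < \<infinity> \<and>
     (\<exists>c\<in>V. \<forall>x\<in>\<V>. \<zeta> (real_of_ereal (fixation_time \<zeta> \<omega>)) \<omega> x = c)"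

end

theory Submission
  imports Defs
begin

text \<open>
  Two functionals of the configuration \<open>\<eta>\<close> drive the proof.  The sum over \<open>x\<close> of the distances from
  \<open>\<eta> x\<close> to the centre of the lattice is a supermartingale: the two orientations of an edge ring at
  the same rate, and moving two coordinates one step towards each other does not increase the sum of
  their absolute values.  The coordinate sums of \<open>\<eta>\<close> are martingales changing by one unit at each
  update, so the expectation of the sum of their squares grows at a rate equal to the number of
  compatible directed edges; as it is bounded, the configuration at time \<open>t\<close> is absorbing up to
  probability \<open>O(1 / t)\<close>.  In an absorbing configuration without consensus, every opinion agrees with
  one endpoint of an edge whose endpoints are more than \<open>\<tau>\<close> apart, hence lies at distance at least
  \<open>\<tau> + 1 - r\<close> from the centre, and Markov's inequality concludes.

  To compute expectations from the graphical construction, time is cut into steps of length \<open>h\<close>, and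
  the process is compared with the chain that performs an update when exactly one clock advances, by
  one, during a step, and stays put otherwise.  This chain has an exact one-step generator, and the
  two differ at time \<open>t\<close> with probability \<open>O(h)\<close>.
\<close>

section \<open>Independence and finite expectations\<close>

text \<open>The obstacle is that \<open>attraction_process\<close> provides only the graphical
  construction: no Markov property and no generator. Conditioning on the past is delicate because
  the choice consumed at an activation of \<open>e\<close> is indexed by the random count of
  \<open>e\<close>, so which source is fresh depends on the past. The remedy is to fix the count
  \<open>k\<close>: on that event the chain has not yet consumed choice \<open>k + 1\<close> of
  \<open>e\<close>, and summing over \<open>k\<close> recovers the one-step law. The step length
  tends to 0 at a fixed time; only afterwards does the time tend to infinity.

  Constants: L(L+1)/(2L+1) is the mean of |U| for U uniform on {-L..L}, so the sum over coordinates
  is the mean initial distance of one opinion from the centre. The number of vertices multiplies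
  both sides of Markov's inequality and cancels. The bound tau + 1 - r is a triangle inequality, r
  being the largest distance from the centre; it is positive because r is at most tau.\<close>

lemma (in prob_space) indep_sets_refine:
  assumes F: "indep_sets F I"
    and Int: "\<And>i. i \<in> I \<Longrightarrow> Int_stable (F i)"
    and G: "\<And>i. i \<in> I \<Longrightarrow> indep_sets (G i) (J i)"
    and sub: "\<And>i j. i \<in> I \<Longrightarrow> j \<in> J i \<Longrightarrow> G i j \<subseteq> F i"
  shows "indep_sets (\<lambda>(i, j). G i j) (SIGMA i:I. J i)"
proof (rule indep_setsI)
  fix p assume "p \<in> Sigma I J"
  then show "(case p of (i, j) \<Rightarrow> G i j) \<subseteq> events"
    using F sub unfolding indep_sets_def by fast
next
  fix A K
  assume K: "K \<noteq> {}" "K \<subseteq> Sigma I J" "finite K"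
    and A: "\<forall>p\<in>K. A p \<in> (case p of (i, j) \<Rightarrow> G i j)"
  \<comment> \<open>The finitely many events of \<open>K\<close> are grouped by their coarse index.
    \<open>Int_stable\<close> puts each group intersection \<open>B i\<close> back into
    \<open>F i\<close>, so independence of \<open>F\<close> factors over the groups and independence
    of \<open>G i\<close> factors within each group.\<close>
  define Ki where "Ki i = {j. (i, j) \<in> K}" for i
  define B where "B i = (\<Inter>j\<in>Ki i. A (i, j))" for i
  have fin: "finite (Ki i)" for i
    by (rule finite_subset[of _ "snd ` K"]) (force simp: Ki_def K(3))+
  have ne: "Ki i \<noteq> {}" "i \<in> I" if "i \<in> fst ` K" for i
    using that K(2) by (auto simp: Ki_def)
  have KJ: "Ki i \<subseteq> J i" for i using K(2) by (auto simp: Ki_def)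
  have AG: "A (i, j) \<in> G i j" if "j \<in> Ki i" for i j
    using A that by (force simp: Ki_def)
  have BF: "B i \<in> F i" if i: "i \<in> fst ` K" for i
  proof -
    have "(\<Inter>j\<in>H. A (i, j)) \<in> F i" if "finite H" "H \<noteq> {}" "H \<subseteq> Ki i" for H
      using that
    proof (induction H rule: finite_ne_induct)
      case (singleton j)
      then have "A (i, j) \<in> F i" using AG[of j i] sub[OF ne(2)[OF i], of j] KJ[of i] by blast
      then show ?case by simp
    next
      case (insert j H)
      then have "A (i, j) \<in> F i" using AG[of j i] sub[OF ne(2)[OF i], of j] KJ[of i] by blast
      with insert show ?case using Int_stableD[OF Int[OF ne(2)[OF i]]] by auto
    qed
    then show ?thesis unfolding B_def using fin ne[OF i] by blast
  qed
  have KS: "K = Sigma (fst ` K) Ki" by (force simp: Ki_def)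
  have "(\<Inter>p\<in>K. A p) = (\<Inter>i\<in>fst ` K. B i)"
    by (subst KS) (auto simp: B_def)
  then have "prob (\<Inter>p\<in>K. A p) = (\<Prod>i\<in>fst ` K. prob (B i))"
    using indep_setsD[OF F subsetI[OF ne(2)] _ _ ballI[OF BF], of "fst ` K"] K by simp
  also have "\<dots> = (\<Prod>i\<in>fst ` K. \<Prod>j\<in>Ki i. prob (A (i, j)))"
  proof (rule prod.cong[OF refl])
    fix i assume i: "i \<in> fst ` K"
    show "prob (B i) = (\<Prod>j\<in>Ki i. prob (A (i, j)))"
      unfolding B_def
      using indep_setsD[OF G[OF ne(2)[OF i]], of "Ki i" "\<lambda>j. A (i, j)"] AG KJ fin ne[OF i] by auto
  qed
  also have "\<dots> = (\<Prod>p\<in>Sigma (fst ` K) Ki. prob (A p))"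
    using K(3) fin by (subst prod.Sigma) auto
  finally show "prob (\<Inter>p\<in>K. A p) = (\<Prod>p\<in>K. prob (A p))"
    using KS by simp
qed

text \<open>The form in which independence is consumed: one event of a collected past against
  finitely many fresh sources. Gathering everything outside \<open>W\<close> into a single block,
  indexed by \<open>None\<close>, while each \<open>w\<close> keeps its own block
  \<open>Some w\<close>, reduces it to \<open>indep_sets_collect_sigma\<close>.\<close>

lemma (in prob_space) indep_sets_split:
  assumes F: "indep_sets F I"
    and Int: "\<And>i. i \<in> I \<Longrightarrow> Int_stable (F i)"
    and W: "W \<subseteq> I" "finite W"
    and A: "A \<in> sigma_sets (space M) (\<Union>i\<in>I - W. F i)"
    and B: "\<And>w. w \<in> W \<Longrightarrow> B w \<in> F w"
  shows "prob (A \<inter> (\<Inter>w\<in>W. B w)) = prob A * (\<Prod>w\<in>W. prob (B w))"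
proof -
  define Q where "Q j = (case j of None \<Rightarrow> I - W | Some w \<Rightarrow> {w})" for j
  have "indep_sets (\<lambda>j. sigma_sets (space M) (\<Union>i\<in>Q j. F i)) (insert None (Some ` W))"
  proof (rule indep_sets_collect_sigma)
    have "(\<Union>j\<in>insert None (Some ` W). Q j) = I" using W by (auto simp: Q_def)
    then show "indep_sets F (\<Union>j\<in>insert None (Some ` W). Q j)" using F by simp
    show "Int_stable (F i)" if "j \<in> insert None (Some ` W)" "i \<in> Q j" for i j
      using that Int W by (auto simp: Q_def)
    show "disjoint_family_on Q (insert None (Some ` W))"
      by (auto simp: disjoint_family_on_def Q_def)
  qed
  from indep_setsD[OF this subset_refl, of "case_option A B"]
  have "prob (\<Inter>j\<in>insert None (Some ` W). case_option A B j) =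
      (\<Prod>j\<in>insert None (Some ` W). prob (case_option A B j))"
    using W A B by (auto simp: Q_def)
  moreover have "(\<Inter>j\<in>insert None (Some ` W). case_option A B j) = A \<inter> (\<Inter>w\<in>W. B w)" by auto
  ultimately show ?thesis using W by (simp add: prod.reindex)
qed

lemma pred_eq_count_space:
  assumes "f \<in> M \<rightarrow>\<^sub>M count_space A"
  shows "Measurable.pred M (\<lambda>\<omega>. f \<omega> = v)"
proof -
  have "f -` ({v} \<inter> A) \<inter> space M \<in> sets M"
    using assms by (rule measurable_sets) simp
  also have "f -` ({v} \<inter> A) \<inter> space M = {\<omega> \<in> space M. f \<omega> = v}"
    using measurable_space[OF assms] by auto
  finally show ?thesis by (simp add: pred_def)
qed

text \<open>Configurations form a finite set, so every expectation below is a finite sum over the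
  events \<open>X = a\<close>. Stating measurability through these events avoids fixing a
  sigma-algebra on the values.\<close>

lemma (in prob_space) expectation_finite_valued:
  fixes g :: "'b \<Rightarrow> real"
  assumes fin: "finite A" and X: "\<And>\<omega>. \<omega> \<in> space M \<Longrightarrow> X \<omega> \<in> A"
    and meas: "\<And>a. Measurable.pred M (\<lambda>\<omega>. X \<omega> = a)"
  shows "integrable M (\<lambda>\<omega>. g (X \<omega>))"
    and "expectation (\<lambda>\<omega>. g (X \<omega>)) = (\<Sum>a\<in>A. prob {\<omega> \<in> space M. X \<omega> = a} * g a)"
proof -
  have eq: "g (X \<omega>) = (\<Sum>a\<in>A. g a * indicator {\<omega> \<in> space M. X \<omega> = a} \<omega>)" if "\<omega> \<in> space M" for \<omega>
  proof -
    have "(\<Sum>a\<in>A. g a * indicator {\<omega> \<in> space M. X \<omega> = a} \<omega>) = (\<Sum>a\<in>A. if X \<omega> = a then g a else 0)"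
      using that by (intro sum.cong) (auto simp: indicator_def)
    then show ?thesis using X[OF that] fin by simp
  qed
  have ev: "{\<omega> \<in> space M. X \<omega> = a} \<in> events" for a using meas[of a] by (simp add: pred_def)
  have int: "integrable M (\<lambda>\<omega>. g a * indicator {\<omega> \<in> space M. X \<omega> = a} \<omega>)" for a
    using ev by (intro integrable_mult_right integrable_real_indicator) (auto simp: emeasure_eq_measure)
  have "integrable M (\<lambda>\<omega>. \<Sum>a\<in>A. g a * indicator {\<omega> \<in> space M. X \<omega> = a} \<omega>)"
    by (intro Bochner_Integration.integrable_sum int)
  then show "integrable M (\<lambda>\<omega>. g (X \<omega>))"
    by (subst Bochner_Integration.integrable_cong[OF refl eq])
  have "expectation (\<lambda>\<omega>. g (X \<omega>)) =
      expectation (\<lambda>\<omega>. \<Sum>a\<in>A. g a * indicator {\<omega> \<in> space M. X \<omega> = a} \<omega>)"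
    by (intro Bochner_Integration.integral_cong refl eq)
  also have "\<dots> = (\<Sum>a\<in>A. expectation (\<lambda>\<omega>. g a * indicator {\<omega> \<in> space M. X \<omega> = a} \<omega>))"
    by (intro Bochner_Integration.integral_sum int)
  also have "\<dots> = (\<Sum>a\<in>A. prob {\<omega> \<in> space M. X \<omega> = a} * g a)"
    using ev by (intro sum.cong) auto
  finally show "expectation (\<lambda>\<omega>. g (X \<omega>)) = (\<Sum>a\<in>A. prob {\<omega> \<in> space M. X \<omega> = a} * g a)" .
qed

section \<open>Paths of the attraction process\<close>

lemma finite_dir_edges:
  assumes "simple_graph V E" "finite V"
  shows "finite (dir_edges E)"
  by (rule finite_subset[of _ "V \<times> V"])
     (use assms in \<open>auto simp: simple_graph_def dir_edges_def doubleton_eq_iff\<close>)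

lemma dir_edges_mem:
  assumes "simple_graph V E" "(x, y) \<in> dir_edges E"
  shows "x \<in> V" "y \<in> V" "x \<noteq> y" "(y, x) \<in> dir_edges E"
  using assms by (auto simp: simple_graph_def dir_edges_def doubleton_eq_iff insert_commute)

text \<open>Right-continuity makes the infimum a minimum: the path is constant on some
  \<open>[T, b)\<close>, and a fixation instant \<open>u\<close> smaller than \<open>min s b\<close>
  links the value at \<open>T\<close> to the value at \<open>s\<close>.\<close>

lemma fixation_time_attained:
  assumes rc: "\<And>t. 0 \<le> t \<Longrightarrow> \<forall>\<^sub>F s in at_right t. \<zeta> s \<omega> = \<zeta> t \<omega>"
    and t: "fixation_time \<zeta> \<omega> < \<infinity>"
  obtains T where "0 \<le> T" "fixation_time \<zeta> \<omega> = ereal T" "\<And>s. T \<le> s \<Longrightarrow> \<zeta> s \<omega> = \<zeta> T \<omega>"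
proof -
  let ?X = "{ereal t | t. 0 \<le> t \<and> (\<forall>s>t. \<zeta> t \<omega> = \<zeta> s \<omega>)}"
  have "0 \<le> fixation_time \<zeta> \<omega>" unfolding fixation_time_def by (rule Inf_greatest) auto
  with t obtain T where T: "fixation_time \<zeta> \<omega> = ereal T" "0 \<le> T"
    by (cases "fixation_time \<zeta> \<omega>") auto
  obtain b where b: "b > T" "\<And>u. T < u \<Longrightarrow> u < b \<Longrightarrow> \<zeta> u \<omega> = \<zeta> T \<omega>"
    using rc[OF T(2)] unfolding eventually_at_right_field by auto
  have "\<zeta> s \<omega> = \<zeta> T \<omega>" if s: "T < s" for s
  proof -
    have "Inf ?X < ereal (min s b)" using T(1) s b(1) by (simp add: fixation_time_def)
    then obtain u where u: "0 \<le> u" "\<forall>s>u. \<zeta> u \<omega> = \<zeta> s \<omega>" "u < min s b"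
      unfolding Inf_less_iff by auto
    have "Inf ?X \<le> ereal u" using u by (intro Inf_lower) auto
    then have "T \<le> u" using T(1) by (simp add: fixation_time_def)
    then have "\<zeta> u \<omega> = \<zeta> T \<omega>" using b(2)[of u] u(3) by (cases "u = T") auto
    moreover have "\<zeta> u \<omega> = \<zeta> s \<omega>" using u by simp
    ultimately show ?thesis by simp
  qed
  then show thesis using T by (intro that[of T]) (auto simp: order_le_less)
qed

text \<open>A description of consensus by countably many events, for measurability in
  \<open>fixates_event\<close>. Rational times suffice because right-continuity provides a rational
  time just after \<open>s\<close> at which the path still has its value at
  \<open>s\<close>.\<close>

lemma fixates_to_constant_iff:
  assumes rc: "\<And>t. 0 \<le> t \<Longrightarrow> \<forall>\<^sub>F s in at_right t. \<zeta> s \<omega> = \<zeta> t \<omega>"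
    and S: "\<And>t. 0 \<le> t \<Longrightarrow> \<zeta> t \<omega> \<in> \<V> \<rightarrow>\<^sub>E V"
  shows "fixates_to_constant V \<V> \<zeta> \<omega> \<longleftrightarrow>
    (\<exists>n::nat. \<exists>c\<in>V. \<forall>q::rat. real n \<le> of_rat q \<longrightarrow> \<zeta> (of_rat q) \<omega> = (\<lambda>x\<in>\<V>. c))"
proof
  assume fx: "fixates_to_constant V \<V> \<zeta> \<omega>"
  then obtain T where T: "0 \<le> T" "fixation_time \<zeta> \<omega> = ereal T" "\<And>s. T \<le> s \<Longrightarrow> \<zeta> s \<omega> = \<zeta> T \<omega>"
    using fixation_time_attained[of \<zeta> \<omega>, OF rc] unfolding fixates_to_constant_def by blast
  obtain c where c: "c \<in> V" "\<forall>x\<in>\<V>. \<zeta> T \<omega> x = c"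
    using fx T(2) by (auto simp: fixates_to_constant_def)
  have const: "\<zeta> T \<omega> = (\<lambda>x\<in>\<V>. c)"
    using S[OF T(1)] c(2) by (auto simp: PiE_iff extensional_def fun_eq_iff)
  obtain n :: nat where "T \<le> real n" using real_arch_simple by blast
  then have "\<forall>q::rat. real n \<le> of_rat q \<longrightarrow> \<zeta> (of_rat q) \<omega> = (\<lambda>x\<in>\<V>. c)"
    using T(3) const by (metis order_trans)
  with c(1) show "\<exists>n::nat. \<exists>c\<in>V. \<forall>q::rat. real n \<le> of_rat q \<longrightarrow> \<zeta> (of_rat q) \<omega> = (\<lambda>x\<in>\<V>. c)" by blast
next
  assume "\<exists>n::nat. \<exists>c\<in>V. \<forall>q::rat. real n \<le> of_rat q \<longrightarrow> \<zeta> (of_rat q) \<omega> = (\<lambda>x\<in>\<V>. c)"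
  then obtain n c where c: "c \<in> V" and q: "\<And>q::rat. real n \<le> of_rat q \<Longrightarrow> \<zeta> (of_rat q) \<omega> = (\<lambda>x\<in>\<V>. c)"
    by blast
  have const: "\<zeta> s \<omega> = (\<lambda>x\<in>\<V>. c)" if s: "real n \<le> s" for s
  proof -
    have "0 \<le> s" using s by linarith
    then obtain b where b: "b > s" "\<And>u. s < u \<Longrightarrow> u < b \<Longrightarrow> \<zeta> u \<omega> = \<zeta> s \<omega>"
      using rc[of s] unfolding eventually_at_right_field by auto
    obtain q' :: rat where q': "s < of_rat q'" "of_rat q' < b" using of_rat_dense[OF b(1)] by blast
    then show ?thesis using b(2)[of "of_rat q'"] q[of q'] s by simp
  qed
  have "Inf {ereal t | t. 0 \<le> t \<and> (\<forall>s>t. \<zeta> t \<omega> = \<zeta> s \<omega>)} \<le> ereal (real n)"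
    using const by (intro Inf_lower) auto
  then have fin: "fixation_time \<zeta> \<omega> < \<infinity>" unfolding fixation_time_def by (rule le_less_trans) simp
  then obtain T where T: "0 \<le> T" "fixation_time \<zeta> \<omega> = ereal T" "\<And>s. T \<le> s \<Longrightarrow> \<zeta> s \<omega> = \<zeta> T \<omega>"
    using fixation_time_attained[of \<zeta> \<omega>, OF rc] by blast
  have "\<zeta> T \<omega> = (\<lambda>x\<in>\<V>. c)"
    using T(3)[of "max T (real n)"] const[of "max T (real n)"] by simp
  then show "fixates_to_constant V \<V> \<zeta> \<omega>"
    using fin c T(2) by (auto simp: fixates_to_constant_def)
qed

text \<open>One witness \<open>N\<close>, \<open>C\<close> of the existential in
  \<open>attraction_process\<close> is fixed here, so that clocks and choices have names. The
  opinion set is any finite one; the lattice enters only in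
  \<open>lattice_attraction\<close>.\<close>

locale attraction_graphical = prob_space M for M :: "'w measure" +
  fixes V :: "'o set" and E :: "'o set set" and \<V> :: "'v set" and \<E> :: "'v set set"
    and \<tau> :: nat and \<zeta> :: "real \<Rightarrow> 'w \<Rightarrow> 'v \<Rightarrow> 'o"
    and N :: "'v \<times> 'v \<Rightarrow> real \<Rightarrow> 'w \<Rightarrow> nat"
    and C :: "'v \<times> 'v \<Rightarrow> nat \<Rightarrow> 'o \<Rightarrow> 'o \<Rightarrow> 'w \<Rightarrow> 'o"
  assumes finV: "finite V" and fin\<V>: "finite \<V>" and sg: "simple_graph \<V> \<E>"
    and meas_\<zeta>: "\<And>t. 0 \<le> t \<Longrightarrow> \<zeta> t \<in> M \<rightarrow>\<^sub>M count_space (\<V> \<rightarrow>\<^sub>E V)"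
    and right_cont: "\<And>\<omega> t. \<omega> \<in> space M \<Longrightarrow> 0 \<le> t \<Longrightarrow> \<forall>\<^sub>F s in at_right t. \<zeta> s \<omega> = \<zeta> t \<omega>"
    and poisson: "\<And>e. e \<in> dir_edges \<E> \<Longrightarrow> poisson_process 1 (N e)"
    and choice_rv: "\<And>e k a b. e \<in> dir_edges \<E> \<Longrightarrow> a \<in> V \<Longrightarrow> b \<in> V \<Longrightarrow> compatible E \<tau> a b \<Longrightarrow>
        C e k a b \<in> M \<rightarrow>\<^sub>M count_space (closer_nbrs V E a b)"
    and choice_distr: "\<And>e k a b. e \<in> dir_edges \<E> \<Longrightarrow> a \<in> V \<Longrightarrow> b \<in> V \<Longrightarrow> compatible E \<tau> a b \<Longrightarrow>
        distr M (count_space (closer_nbrs V E a b)) (C e k a b) =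
          uniform_count_measure (closer_nbrs V E a b)"
    and indep: "indep_sets (source_algebra (space M) (\<zeta> 0) N C) (sources V E \<E> \<tau>)"
    and rule: "AE \<omega> in M. \<forall>t>0. \<exists>\<eta>.
           (\<forall>\<^sub>F s in at_left t. \<zeta> s \<omega> = \<eta>) \<and>
           ((\<forall>e\<in>dir_edges \<E>. \<not> rings (N e) t \<omega>) \<longrightarrow> \<zeta> t \<omega> = \<eta>) \<and>
           (\<forall>(x, y)\<in>dir_edges \<E>. rings (N (x, y)) t \<omega> \<longrightarrow>
              \<zeta> t \<omega> =
                (if compatible E \<tau> (\<eta> x) (\<eta> y)
                 then \<eta>(x := C (x, y) (N (x, y) t \<omega>) (\<eta> x) (\<eta> y) \<omega>)
                 else \<eta>))"
begin

abbreviation "D \<equiv> dir_edges \<E>"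
abbreviation "S \<equiv> \<V> \<rightarrow>\<^sub>E V"

definition absorbing :: "('v \<Rightarrow> 'o) \<Rightarrow> bool" where
  "absorbing \<eta> \<longleftrightarrow> (\<forall>(x, y)\<in>D. \<not> compatible E \<tau> (\<eta> x) (\<eta> y))"

text \<open>The choices \<open>c\<close> are a parameter because \<open>past_event\<close> runs the
  chain with some of the variables in \<open>C\<close> replaced.\<close>

definition update ::
  "('v \<times> 'v \<Rightarrow> nat \<Rightarrow> 'o \<Rightarrow> 'o \<Rightarrow> 'w \<Rightarrow> 'o) \<Rightarrow> 'v \<times> 'v \<Rightarrow> nat \<Rightarrow> ('v \<Rightarrow> 'o) \<Rightarrow> 'w \<Rightarrow> 'v \<Rightarrow> 'o" where
  "update c e k \<eta> \<omega> =
     (if compatible E \<tau> (\<eta> (fst e)) (\<eta> (snd e))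
      then \<eta>(fst e := c e k (\<eta> (fst e)) (\<eta> (snd e)) \<omega>) else \<eta>)"

text \<open>The almost sure event on which all path arguments become deterministic.\<close>

definition well_driven :: "'w \<Rightarrow> bool" where
  "well_driven \<omega> \<longleftrightarrow> (\<forall>t>0. \<exists>\<eta>.
     (\<forall>\<^sub>F s in at_left t. \<zeta> s \<omega> = \<eta>) \<and>
     ((\<forall>e\<in>D. \<not> rings (N e) t \<omega>) \<longrightarrow> \<zeta> t \<omega> = \<eta>) \<and>
     (\<forall>e\<in>D. rings (N e) t \<omega> \<longrightarrow> \<zeta> t \<omega> = update C e (N e t \<omega>) \<eta> \<omega>))"

lemma AE_well_driven: "AE \<omega> in M. well_driven \<omega>"
  using rule unfolding well_driven_def update_def by (simp add: case_prod_beta' cong: if_cong)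

lemma finD: "finite D"
  using finite_dir_edges[OF sg fin\<V>] .

lemma finS: "finite S"
  using finV fin\<V> by (rule finite_PiE[rotated])

lemma \<zeta>_in_S: "0 \<le> t \<Longrightarrow> \<omega> \<in> space M \<Longrightarrow> \<zeta> t \<omega> \<in> S"
  using measurable_space[OF meas_\<zeta>] by (simp add: PiE_def)

lemma C_in:
  "\<lbrakk>e \<in> D; a \<in> V; b \<in> V; compatible E \<tau> a b; \<omega> \<in> space M\<rbrakk> \<Longrightarrow> C e k a b \<omega> \<in> closer_nbrs V E a b"
  using measurable_space[OF choice_rv] by simp

lemma N_mono: "\<lbrakk>e \<in> D; \<omega> \<in> space M; 0 \<le> s; s \<le> t\<rbrakk> \<Longrightarrow> N e s \<omega> \<le> N e t \<omega>"
  using poisson[of e] unfolding poisson_process_def mono_on_def by force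

lemma N_zero: "\<lbrakk>e \<in> D; \<omega> \<in> space M\<rbrakk> \<Longrightarrow> N e 0 \<omega> = 0"
  using poisson[of e] unfolding poisson_process_def by blast

lemma N_right_cont:
  "\<lbrakk>e \<in> D; \<omega> \<in> space M; 0 \<le> t\<rbrakk> \<Longrightarrow> \<forall>\<^sub>F s in at_right t. N e s \<omega> = N e t \<omega>"
  using poisson[of e] unfolding poisson_process_def by blast

text \<open>The dynamics is known only locally, through left limits, right-continuity and the rule
  at each instant. \<open>Bolzano\<close> passes from short intervals around each point to
  \<open>[s, t]\<close>, without counting jumps. Blocking refers to the configuration at the left
  endpoint, which covers both absorbing configurations and silent clocks.\<close>

lemma constant_while_blocked:
  assumes wd: "well_driven \<omega>" and \<omega>: "\<omega> \<in> space M" and st: "0 \<le> s" "s \<le> t"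
    and blocked: "\<And>e u. \<lbrakk>e \<in> D; s < u; u \<le> t; rings (N e) u \<omega>\<rbrakk> \<Longrightarrow>
        \<not> compatible E \<tau> (\<zeta> s \<omega> (fst e)) (\<zeta> s \<omega> (snd e))"
  shows "\<zeta> t \<omega> = \<zeta> s \<omega>"
proof -
  \<comment> \<open>Intervals \<open>[a, b]\<close> and \<open>[b, c]\<close> concatenate since
    equal configurations at \<open>a\<close> and \<open>b\<close> carry the blocking hypothesis
    over. The guard \<open>0 \<le> a\<close> excludes negative times, where \<open>\<zeta>\<close>
    is uncontrolled but which \<open>Bolzano\<close> also presents.\<close>
  define P where "P a b \<longleftrightarrow> 0 \<le> a \<longrightarrow>
      (\<forall>e\<in>D. \<forall>u. a < u \<and> u \<le> b \<and> rings (N e) u \<omega> \<longrightarrow>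
        \<not> compatible E \<tau> (\<zeta> a \<omega> (fst e)) (\<zeta> a \<omega> (snd e))) \<longrightarrow> \<zeta> b \<omega> = \<zeta> a \<omega>" for a b
  have "P s t"
  proof (rule Bolzano[OF st(2)])
    fix a b c assume h: "P a b" "P b c" "a \<le> b" "b \<le> c"
    show "P a c"
      unfolding P_def
    proof (intro impI)
      assume a: "0 \<le> a" and bl: "\<forall>e\<in>D. \<forall>u. a < u \<and> u \<le> c \<and> rings (N e) u \<omega> \<longrightarrow>
        \<not> compatible E \<tau> (\<zeta> a \<omega> (fst e)) (\<zeta> a \<omega> (snd e))"
      have ab: "\<zeta> b \<omega> = \<zeta> a \<omega>" using h(1) a bl h(3,4) unfolding P_def by auto
      then have "\<zeta> c \<omega> = \<zeta> b \<omega>"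
        using h(2) a bl h(3,4) unfolding P_def by auto
      with ab show "\<zeta> c \<omega> = \<zeta> a \<omega>" by simp
    qed
  next
    fix x assume x: "s \<le> x" "x \<le> t"
    then have x0: "0 \<le> x" using st by simp
    obtain d1 where d1: "d1 > x" "\<And>u. x < u \<Longrightarrow> u < d1 \<Longrightarrow> \<zeta> u \<omega> = \<zeta> x \<omega>"
      using right_cont[OF \<omega> x0] unfolding eventually_at_right_field by auto
    have right: "\<zeta> b \<omega> = \<zeta> x \<omega>" if "x \<le> b" "b < d1" for b
      using d1(2)[of b] that by (cases "b = x") auto
    have "\<exists>d>0. \<forall>a. 0 \<le> a \<and> a < x \<and> x - a < d \<longrightarrow> P a x"
    proof (cases "x = 0")
      case True then show ?thesis by (intro exI[of _ 1]) auto
    next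
      case False
      with x0 wd obtain \<eta> where \<eta>: "\<forall>\<^sub>F s in at_left x. \<zeta> s \<omega> = \<eta>"
        "(\<forall>e\<in>D. \<not> rings (N e) x \<omega>) \<longrightarrow> \<zeta> x \<omega> = \<eta>"
        "\<forall>e\<in>D. rings (N e) x \<omega> \<longrightarrow> \<zeta> x \<omega> = update C e (N e x \<omega>) \<eta> \<omega>"
        unfolding well_driven_def by (elim allE[of _ x]) auto
      obtain d2 where d2: "d2 < x" "\<And>u. d2 < u \<Longrightarrow> u < x \<Longrightarrow> \<zeta> u \<omega> = \<eta>"
        using \<eta>(1) unfolding eventually_at_left_field by auto
      show ?thesis
      proof (intro exI[of _ "x - d2"] conjI allI impI)
        show "0 < x - d2" using d2 by simp
        fix a assume a: "0 \<le> a \<and> a < x \<and> x - a < x - d2"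
        then have "\<zeta> a \<omega> = \<eta>" using d2(2)[of a] by simp
        have "\<zeta> x \<omega> = \<eta>"
          if "\<forall>e\<in>D. \<forall>u. a < u \<and> u \<le> x \<and> rings (N e) u \<omega> \<longrightarrow>
            \<not> compatible E \<tau> (\<eta> (fst e)) (\<eta> (snd e))"
        proof (cases "\<exists>e\<in>D. rings (N e) x \<omega>")
          case True
          then obtain e where e: "e \<in> D" "rings (N e) x \<omega>" by blast
          then have "\<not> compatible E \<tau> (\<eta> (fst e)) (\<eta> (snd e))" using that a by auto
          then show ?thesis using \<eta>(3) e by (simp add: update_def)
        qed (use \<eta>(2) in blast)
        with \<open>\<zeta> a \<omega> = \<eta>\<close> show "P a x" by (simp add: P_def)
      qed
    qed
    then obtain d where d: "d > 0" "\<And>a. 0 \<le> a \<Longrightarrow> a < x \<Longrightarrow> x - a < d \<Longrightarrow> P a x" by blast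
    show "\<exists>d>0. \<forall>a b. a \<le> x \<and> x \<le> b \<and> b - a < d \<longrightarrow> P a b"
    proof (intro exI[of _ "min d (d1 - x)"] conjI allI impI)
      show "0 < min d (d1 - x)" using d(1) d1(1) by simp
      fix a b assume ab: "a \<le> x \<and> x \<le> b \<and> b - a < min d (d1 - x)"
      then have b: "\<zeta> b \<omega> = \<zeta> x \<omega>" by (intro right) auto
      show "P a b"
      proof (cases "a = x")
        case True then show ?thesis using b by (simp add: P_def)
      next
        case False
        then have "0 \<le> a \<Longrightarrow> P a x" using ab by (intro d(2)) auto
        then show ?thesis using b ab unfolding P_def by force
      qed
    qed
  qed
  then show ?thesis using st blocked unfolding P_def by blast
qed

lemma absorbing_forever:
  assumes "well_driven \<omega>" "\<omega> \<in> space M" "0 \<le> s" "s \<le> t" "absorbing (\<zeta> s \<omega>)"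
  shows "\<zeta> t \<omega> = \<zeta> s \<omega>"
  using assms by (intro constant_while_blocked) (auto simp: absorbing_def)

lemma no_ring:
  assumes "e \<in> D" "\<omega> \<in> space M" "0 \<le> s" "s < u" "u \<le> t" "N e t \<omega> = N e s \<omega>"
  shows "\<not> rings (N e) u \<omega>"
proof
  assume "rings (N e) u \<omega>"
  then have "N e s \<omega> < N e u \<omega>" using assms by (auto simp: rings_def)
  also have "\<dots> \<le> N e t \<omega>" using assms by (intro N_mono) auto
  finally show False using assms by simp
qed

lemma update_of_single_ring:
  assumes wd: "well_driven \<omega>" and \<omega>: "\<omega> \<in> space M" and st: "0 \<le> s" "s \<le> t" and e: "e \<in> D"
    and one: "N e t \<omega> = Suc (N e s \<omega>)"
    and zero: "\<And>e'. e' \<in> D \<Longrightarrow> e' \<noteq> e \<Longrightarrow> N e' t \<omega> = N e' s \<omega>"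
  shows "\<zeta> t \<omega> = update C e (N e t \<omega>) (\<zeta> s \<omega>) \<omega>"
proof -
  \<comment> \<open>\<open>z = Inf T\<close> is the instant of the ring: right-continuity of the
    clock gives the final count at \<open>z\<close> itself, and before \<open>z\<close> the count,
    lying between two consecutive integers, is still the initial one.\<close>
  define T where "T = {u. s \<le> u \<and> u \<le> t \<and> N e u \<omega> = N e t \<omega>}"
  define z where "z = Inf T"
  have tT: "t \<in> T" using st by (simp add: T_def)
  have bdd: "bdd_below T" by (rule bdd_belowI[of _ s]) (simp add: T_def)
  have zs: "s \<le> z" unfolding z_def using tT by (intro cInf_greatest) (auto simp: T_def)
  have zt: "z \<le> t" unfolding z_def using tT bdd by (rule cInf_lower)
  have above: "N e u \<omega> = N e t \<omega>" if u: "z < u" "u \<le> t" for u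
  proof -
    obtain v where "v \<in> T" "v < u"
      using cInf_lessD[of T u] u tT by (auto simp: z_def)
    then have "N e t \<omega> \<le> N e u \<omega>" using N_mono[OF e \<omega>, of v u] st by (auto simp: T_def)
    then show ?thesis using N_mono[OF e \<omega>, of u t] u zs st by auto
  qed
  have Nz: "N e z \<omega> = N e t \<omega>"
  proof (cases "z = t")
    case False
    obtain b where b: "b > z" "\<And>u. z < u \<Longrightarrow> u < b \<Longrightarrow> N e u \<omega> = N e z \<omega>"
      using N_right_cont[OF e \<omega>, of z] zs st unfolding eventually_at_right_field by auto
    obtain u where "z < u" "u < min b t" using dense[of z "min b t"] b zt False by auto
    then show ?thesis using b(2)[of u] above[of u] by simp
  qed simp
  have below: "N e u \<omega> = N e s \<omega>" if u: "s \<le> u" "u < z" for u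
  proof -
    have "u \<notin> T" using u bdd cInf_lower[of u T] by (auto simp: z_def)
    then have "N e u \<omega> \<noteq> N e t \<omega>" using u zt by (auto simp: T_def)
    moreover have "N e u \<omega> \<le> N e t \<omega>" "N e s \<omega> \<le> N e u \<omega>"
      using u zt st by (auto intro!: N_mono[OF e \<omega>])
    ultimately show ?thesis using one by simp
  qed
  have sz: "s < z" using zs Nz one by (cases "s = z") auto
  have nor: "\<not> rings (N e') u \<omega>" if "e' \<in> D" "e' \<noteq> e" "s < u" "u \<le> t" for e' u
    using no_ring[OF that(1) \<omega> st(1) that(3,4)] zero that by simp
  have const: "\<zeta> u \<omega> = \<zeta> s \<omega>" if u: "s \<le> u" "u < z" for u
  proof (rule constant_while_blocked[OF wd \<omega> st(1) u(1)])
    fix e' v assume v: "e' \<in> D" "s < v" "v \<le> u" "rings (N e') v \<omega>"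
    have "\<not> rings (N e') v \<omega>"
    proof (cases "e' = e")
      case True
      then show ?thesis using no_ring[OF e \<omega> st(1) v(2,3)] below[OF u] by simp
    next
      case False
      then show ?thesis using nor v u zt by auto
    qed
    with v show "\<not> compatible E \<tau> (\<zeta> s \<omega> (fst e')) (\<zeta> s \<omega> (snd e'))" by simp
  qed
  have "rings (N e) z \<omega>"
    unfolding rings_def
  proof (intro conjI ballI)
    show "0 < z" using sz st by simp
    fix u assume u: "u \<in> {0..<z}"
    have "N e u \<omega> \<le> N e (max u s) \<omega>" using u by (intro N_mono[OF e \<omega>]) auto
    also have "\<dots> = N e s \<omega>" using u sz by (intro below) auto
    finally show "N e u \<omega> < N e z \<omega>" using Nz one by simp
  qed
  moreover have "0 < z" using sz st by simp
  ultimately obtain \<eta> where \<eta>: "\<forall>\<^sub>F v in at_left z. \<zeta> v \<omega> = \<eta>"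
    "\<zeta> z \<omega> = update C e (N e z \<omega>) \<eta> \<omega>"
    using wd e unfolding well_driven_def by blast
  have "\<forall>\<^sub>F v in at_left z. \<zeta> v \<omega> = \<zeta> s \<omega>"
    unfolding eventually_at_left_field by (intro exI[of _ s] conjI allI impI sz const) auto
  with \<eta>(1) have "\<forall>\<^sub>F v in at_left z. \<eta> = \<zeta> s \<omega>" by eventually_elim simp
  then have "\<eta> = \<zeta> s \<omega>" by simp
  with \<eta>(2) Nz have "\<zeta> z \<omega> = update C e (N e t \<omega>) (\<zeta> s \<omega>) \<omega>" by simp
  moreover have "\<zeta> t \<omega> = \<zeta> z \<omega>"
  proof (rule constant_while_blocked[OF wd \<omega> _ zt])
    show "0 \<le> z" using zs st by simp
    fix e' v assume v: "e' \<in> D" "z < v" "v \<le> t" "rings (N e') v \<omega>"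
    have "\<not> rings (N e') v \<omega>"
    proof (cases "e' = e")
      case True
      then show ?thesis using no_ring[OF e \<omega> _ v(2,3)] Nz zs st by simp
    next
      case False
      then show ?thesis using nor v sz by auto
    qed
    with v show "\<not> compatible E \<tau> (\<zeta> z \<omega> (fst e')) (\<zeta> z \<omega> (snd e'))" by simp
  qed
  ultimately show ?thesis by simp
qed

subsection \<open>The time-discretized chain\<close>

definition incr :: "real \<Rightarrow> nat \<Rightarrow> 'v \<times> 'v \<Rightarrow> 'w \<Rightarrow> nat" where
  "incr h m e \<omega> = N e (h * real (Suc m)) \<omega> - N e (h * real m) \<omega>"

definition sole_ring :: "real \<Rightarrow> nat \<Rightarrow> 'v \<times> 'v \<Rightarrow> 'w \<Rightarrow> bool" where
  "sole_ring h m e \<omega> \<longleftrightarrow> (\<forall>e'\<in>D. incr h m e' \<omega> = (if e' = e then 1 else 0))"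

text \<open>Leaving a step with several activations without effect makes the step probabilities
  exact products. The choice number is the count at the end of the step, so on steps with a single
  activation the chain and the process consume the same choice variable.\<close>

primrec euler ::
  "('v \<times> 'v \<Rightarrow> nat \<Rightarrow> 'o \<Rightarrow> 'o \<Rightarrow> 'w \<Rightarrow> 'o) \<Rightarrow> real \<Rightarrow> nat \<Rightarrow> 'w \<Rightarrow> 'v \<Rightarrow> 'o" where
  "euler c h 0 \<omega> = \<zeta> 0 \<omega>"
| "euler c h (Suc m) \<omega> =
     (if \<exists>e\<in>D. sole_ring h m e \<omega>
      then let e = (THE e. e \<in> D \<and> sole_ring h m e \<omega>)
           in update c e (N e (h * real (Suc m)) \<omega>) (euler c h m \<omega>) \<omega>
      else euler c h m \<omega>)"

lemma sole_ring_unique: "\<lbrakk>e \<in> D; e' \<in> D; sole_ring h m e \<omega>; sole_ring h m e' \<omega>\<rbrakk> \<Longrightarrow> e' = e"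
  unfolding sole_ring_def by (metis zero_neq_one)

lemma euler_sole:
  assumes "e \<in> D" "sole_ring h m e \<omega>"
  shows "euler c h (Suc m) \<omega> = update c e (N e (h * real (Suc m)) \<omega>) (euler c h m \<omega>) \<omega>"
proof -
  have "(THE e. e \<in> D \<and> sole_ring h m e \<omega>) = e"
    using assms sole_ring_unique by blast
  then show ?thesis using assms by (auto simp: Let_def)
qed

text \<open>\<open>incr\<close> is a truncated difference of naturals; monotonicity of the clock
  makes it exact.\<close>

lemma N_Suc_incr:
  assumes "0 \<le> h" "e \<in> D" "\<omega> \<in> space M"
  shows "N e (h * real (Suc m)) \<omega> = N e (h * real m) \<omega> + incr h m e \<omega>"
proof -
  have "N e (h * real m) \<omega> \<le> N e (h * real (Suc m)) \<omega>"
    using assms by (intro N_mono) (auto intro!: mult_left_mono)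
  then show ?thesis by (simp add: incr_def)
qed

text \<open>The choice used by a step is selected by a random count and a random configuration.
  Naming both values, \<open>k\<close> and \<open>\<eta>'\<close>, turns the step into a countable
  combination of events with fixed indices, as measurability requires.\<close>

lemma euler_eq_iff:
  assumes h: "0 \<le> h" and \<omega>: "\<omega> \<in> space M" and S: "euler c h m \<omega> \<in> S"
  shows "euler c h (Suc m) \<omega> = \<eta> \<longleftrightarrow>
    (\<exists>e\<in>D. sole_ring h m e \<omega> \<and>
       (\<exists>k. \<exists>\<eta>'\<in>S. N e (h * real m) \<omega> = k \<and> euler c h m \<omega> = \<eta>' \<and> update c e (Suc k) \<eta>' \<omega> = \<eta>)) \<or>
    ((\<forall>e\<in>D. \<not> sole_ring h m e \<omega>) \<and> euler c h m \<omega> = \<eta>)"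
proof (cases "\<exists>e\<in>D. sole_ring h m e \<omega>")
  case True
  then obtain e where e: "e \<in> D" "sole_ring h m e \<omega>" by blast
  have N: "N e (h * real (Suc m)) \<omega> = Suc (N e (h * real m) \<omega>)"
    using N_Suc_incr[OF h e(1) \<omega>, of m] e by (simp add: sole_ring_def)
  have eul: "euler c h (Suc m) \<omega> = update c e (Suc (N e (h * real m) \<omega>)) (euler c h m \<omega>) \<omega>"
    unfolding euler_sole[OF e] N ..
  show ?thesis
    unfolding eul using e S sole_ring_unique by blast
next
  case False
  then show ?thesis by auto
qed

lemma update_in_S:
  assumes "e \<in> D" "\<eta> \<in> S"
    and "compatible E \<tau> (\<eta> (fst e)) (\<eta> (snd e)) \<Longrightarrow> c e k (\<eta> (fst e)) (\<eta> (snd e)) \<omega> \<in> V"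
  shows "update c e k \<eta> \<omega> \<in> S"
proof -
  have "fst e \<in> \<V>" using dir_edges_mem[OF sg, of "fst e" "snd e"] assms(1) by simp
  then show ?thesis using assms(2,3) by (auto simp: update_def PiE_iff extensional_def)
qed

lemma euler_in_S:
  assumes \<omega>: "\<omega> \<in> space M"
    and c: "\<And>e k a b. \<lbrakk>e \<in> D; a \<in> V; b \<in> V; compatible E \<tau> a b\<rbrakk> \<Longrightarrow> c e k a b \<omega> \<in> V"
  shows "euler c h m \<omega> \<in> S"
proof (induction m)
  case 0
  then show ?case using \<zeta>_in_S[of 0 \<omega>] \<omega> by simp
next
  case (Suc m)
  show ?case
  proof (cases "\<exists>e\<in>D. sole_ring h m e \<omega>")
    case True
    then obtain e where e: "e \<in> D" "sole_ring h m e \<omega>" by blast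
    have "fst e \<in> \<V>" "snd e \<in> \<V>" using dir_edges_mem[OF sg, of "fst e" "snd e"] e by simp_all
    then show ?thesis
      unfolding euler_sole[OF e] using e Suc
      by (intro update_in_S c) (auto simp: PiE_iff)
  next
    case False
    then show ?thesis using Suc by auto
  qed
qed

lemma C_in_V: "\<lbrakk>\<omega> \<in> space M; e \<in> D; a \<in> V; b \<in> V; compatible E \<tau> a b\<rbrakk> \<Longrightarrow> C e k a b \<omega> \<in> V"
  using C_in by (fastforce simp: closer_nbrs_def)

text \<open>\<open>P\<close> is any sigma-algebra on the same space and \<open>c\<close> any choice
  family because there are two uses: \<open>M\<close> with \<open>C\<close> for plain measurability,
  and the past of one step with a modified family. Only increments before step \<open>m\<close> are
  assumed measurable, which makes the conclusion an adaptedness statement.\<close>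

lemma pred_euler:
  assumes h: "0 \<le> h" and sp: "space P = space M"
    and c: "\<And>e k a b \<omega>. \<lbrakk>e \<in> D; a \<in> V; b \<in> V; compatible E \<tau> a b; \<omega> \<in> space M\<rbrakk> \<Longrightarrow> c e k a b \<omega> \<in> V"
    and meas_c: "\<And>e k a b v. \<lbrakk>e \<in> D; a \<in> V; b \<in> V; compatible E \<tau> a b\<rbrakk> \<Longrightarrow>
        Measurable.pred P (\<lambda>\<omega>. c e k a b \<omega> = v)"
    and meas_0: "\<And>\<eta>. Measurable.pred P (\<lambda>\<omega>. \<zeta> 0 \<omega> = \<eta>)"
    and meas_incr: "\<And>i e d. \<lbrakk>i < m; e \<in> D\<rbrakk> \<Longrightarrow> Measurable.pred P (\<lambda>\<omega>. incr h i e \<omega> = d)"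
  shows "i \<le> m \<Longrightarrow> e \<in> D \<Longrightarrow> Measurable.pred P (\<lambda>\<omega>. N e (h * real i) \<omega> = k)"
    and "i \<le> m \<Longrightarrow> Measurable.pred P (\<lambda>\<omega>. euler c h i \<omega> = \<eta>)"
proof -
  show N: "Measurable.pred P (\<lambda>\<omega>. N e (h * real i) \<omega> = k)" if "i \<le> m" "e \<in> D" for i e k
    using that
  proof (induction i arbitrary: k)
    case 0
    have "Measurable.pred P (\<lambda>\<omega>. 0 = k)" by simp
    then show ?case
      by (rule measurable_cong[THEN iffD2, rotated]) (use 0 N_zero sp in auto)
  next
    case (Suc i)
    have [measurable]: "Measurable.pred P (\<lambda>\<omega>. N e (h * real i) \<omega> = l)"
      "Measurable.pred P (\<lambda>\<omega>. incr h i e \<omega> = l)" for l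
      using Suc meas_incr by auto
    have "Measurable.pred P (\<lambda>\<omega>. \<exists>l j. N e (h * real i) \<omega> = l \<and> incr h i e \<omega> = j \<and> l + j = k)"
      by measurable
    then show ?case
      by (rule measurable_cong[THEN iffD2, rotated])
         (use Suc N_Suc_incr[OF h] sp in auto)
  qed
  have sole: "Measurable.pred P (\<lambda>\<omega>. sole_ring h i e \<omega>)" if "i < m" for i e
  proof -
    have [measurable]: "Measurable.pred P (\<lambda>\<omega>. incr h i e \<omega> = l)" if "e \<in> D" for l e
      using that \<open>i < m\<close> meas_incr by auto
    show ?thesis unfolding sole_ring_def using finD by measurable
  qed
  have upd: "Measurable.pred P (\<lambda>\<omega>. update c e k \<eta>' \<omega> = \<eta>)" if "e \<in> D" "\<eta>' \<in> S" for e k \<eta>' \<eta>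
  proof (cases "compatible E \<tau> (\<eta>' (fst e)) (\<eta>' (snd e))")
    case True
    have "fst e \<in> \<V>" "snd e \<in> \<V>" using dir_edges_mem[OF sg, of "fst e" "snd e"] that by simp_all
    then have V: "\<eta>' (fst e) \<in> V" "\<eta>' (snd e) \<in> V" using that by auto
    note meas_c[OF that(1) V True, measurable]
    have "update c e k \<eta>' \<omega> = \<eta> \<longleftrightarrow>
        c e k (\<eta>' (fst e)) (\<eta>' (snd e)) \<omega> = \<eta> (fst e) \<and> \<eta>'(fst e := \<eta> (fst e)) = \<eta>" for \<omega>
      using True by (auto simp: update_def)
    then show ?thesis by simp
  next
    case False
    then show ?thesis by (simp add: update_def)
  qed
  show "Measurable.pred P (\<lambda>\<omega>. euler c h i \<omega> = \<eta>)" if "i \<le> m" for i \<eta>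
    using that
  proof (induction i arbitrary: \<eta>)
    case 0
    then show ?case using meas_0 by simp
  next
    case (Suc i)
    have [measurable]: "Measurable.pred P (\<lambda>\<omega>. euler c h i \<omega> = \<eta>)" for \<eta> using Suc by simp
    have [measurable]: "Measurable.pred P (\<lambda>\<omega>. sole_ring h i e \<omega>)" for e using Suc sole by simp
    have m: "Measurable.pred P (\<lambda>\<omega>. \<exists>k. \<exists>\<eta>'\<in>S. N e (h * real i) \<omega> = k \<and> euler c h i \<omega> = \<eta>' \<and>
        update c e (Suc k) \<eta>' \<omega> = \<eta>)" if "e \<in> D" for e
    proof -
      note [measurable] = upd[OF that] N[OF _ that]
      have [measurable]: "Measurable.pred P (\<lambda>\<omega>. N e (h * real i) \<omega> = k)" for k
        using N[OF _ that] Suc by simp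
      show ?thesis using finS by measurable
    qed
    note [measurable] = m
    have "Measurable.pred P (\<lambda>\<omega>. (\<exists>e\<in>D. sole_ring h i e \<omega> \<and>
       (\<exists>k. \<exists>\<eta>'\<in>S. N e (h * real i) \<omega> = k \<and> euler c h i \<omega> = \<eta>' \<and> update c e (Suc k) \<eta>' \<omega> = \<eta>)) \<or>
      ((\<forall>e\<in>D. \<not> sole_ring h i e \<omega>) \<and> euler c h i \<omega> = \<eta>))"
      using finD by measurable
    moreover have "euler c h (Suc i) \<omega> = \<eta> \<longleftrightarrow> (\<exists>e\<in>D. sole_ring h i e \<omega> \<and>
       (\<exists>k. \<exists>\<eta>'\<in>S. N e (h * real i) \<omega> = k \<and> euler c h i \<omega> = \<eta>' \<and> update c e (Suc k) \<eta>' \<omega> = \<eta>)) \<or>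
      ((\<forall>e\<in>D. \<not> sole_ring h i e \<omega>) \<and> euler c h i \<omega> = \<eta>)" if "\<omega> \<in> space P" for \<omega>
      using that sp by (intro euler_eq_iff[OF h] euler_in_S c) auto
    ultimately show ?case
      by (subst measurable_cong) assumption
  qed
qed

text \<open>Choice number \<open>Suc k\<close> of \<open>e\<close> is read only on a step whose
  final count of \<open>e\<close> is \<open>Suc k\<close>. By monotonicity a count of at most
  \<open>k\<close> at the end excludes this for all earlier steps.\<close>

lemma euler_choice_irrelevant:
  assumes h: "0 \<le> h" and \<omega>: "\<omega> \<in> space M" and e: "e \<in> D"
    and eq: "\<And>e' j. (e', j) \<noteq> (e, Suc k) \<Longrightarrow> c e' j = c' e' j"
  shows "N e (h * real m) \<omega> \<le> k \<Longrightarrow> euler c h m \<omega> = euler c' h m \<omega>"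
proof (induction m)
  case (Suc m)
  have "N e (h * real m) \<omega> \<le> N e (h * real (Suc m)) \<omega>"
    using N_Suc_incr[OF h e \<omega>] by simp
  then have IH: "euler c h m \<omega> = euler c' h m \<omega>" using Suc by simp
  show ?case
  proof (cases "\<exists>e\<in>D. sole_ring h m e \<omega>")
    case True
    then obtain e' where e': "e' \<in> D" "sole_ring h m e' \<omega>" by blast
    have "(e', N e' (h * real (Suc m)) \<omega>) \<noteq> (e, Suc k)" using Suc.prems by auto
    then have "c e' (N e' (h * real (Suc m)) \<omega>) = c' e' (N e' (h * real (Suc m)) \<omega>)" by (rule eq)
    then show ?thesis
      unfolding euler_sole[OF e'] IH update_def by metis
  next
    case False
    then show ?thesis using IH by simp
  qed
qed simp

section \<open>Independence of clock increments and choices\<close>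

definition fine_algebra :: "real \<Rightarrow> ('v, 'o) source \<Rightarrow> nat \<Rightarrow> 'w set set" where
  "fine_algebra h s j = (case s of Clock e \<Rightarrow> {incr h j e -` A \<inter> space M | A. True}
     | _ \<Rightarrow> source_algebra (space M) (\<zeta> 0) N C s)"

text \<open>Independence of whole clocks is too coarse: the increment of the current step must be
  separated from the earlier increments of the same clock. The second index is the step number for
  clocks and the dummy value 0 for the initial configuration and the choices.\<close>

definition fine_index :: "nat \<Rightarrow> (('v, 'o) source \<times> nat) set" where
  "fine_index n = (SIGMA s:sources V E \<E> \<tau>. case s of Clock e \<Rightarrow> {..<n} | _ \<Rightarrow> {0})"

lemma source_algebra_sigma:
  "sigma_sets (space M) (source_algebra (space M) (\<zeta> 0) N C s) = source_algebra (space M) (\<zeta> 0) N C s"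
  by (cases s) (auto intro!: sigma_sets_sigma_sets_eq)

lemma source_algebra_sub: "source_algebra (space M) (\<zeta> 0) N C s \<subseteq> Pow (space M)"
  by (cases s) (auto dest!: sigma_sets_into_sp[rotated])

lemma Int_stable_source_algebra: "Int_stable (source_algebra (space M) (\<zeta> 0) N C s)"
proof -
  interpret sigma_algebra "space M" "source_algebra (space M) (\<zeta> 0) N C s"
    using sigma_algebra_sigma_sets[OF source_algebra_sub, of s] unfolding source_algebra_sigma .
  show ?thesis by (auto simp: Int_stable_def)
qed

lemma Int_stable_fine: "Int_stable (fine_algebra h s j)"
proof (cases s)
  case (Clock e)
  show ?thesis
    unfolding Int_stable_def
  proof (intro ballI)
    fix A B assume "A \<in> fine_algebra h s j" "B \<in> fine_algebra h s j"
    then obtain A' B' where "A = incr h j e -` A' \<inter> space M" "B = incr h j e -` B' \<inter> space M"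
      by (auto simp: fine_algebra_def Clock)
    then have "A \<inter> B = incr h j e -` (A' \<inter> B') \<inter> space M" by auto
    then show "A \<inter> B \<in> fine_algebra h s j" unfolding fine_algebra_def Clock source.case by blast
  qed
qed (use Int_stable_source_algebra[of s] in \<open>simp_all add: fine_algebra_def\<close>)

lemma fine_sub:
  assumes "0 \<le> h"
  shows "fine_algebra h s j \<subseteq> source_algebra (space M) (\<zeta> 0) N C s"
proof (cases s)
  case (Clock e)
  define G where "G = {N e t -` A \<inter> space M | t A. 0 \<le> t}"
  have "G \<subseteq> Pow (space M)" by (auto simp: G_def)
  then have sets: "sets (sigma (space M) G) = sigma_sets (space M) G"
    and sp: "space (sigma (space M) G) = space M" by auto
  have N: "N e t \<in> measurable (sigma (space M) G) (count_space UNIV)" if "0 \<le> t" for t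
    by (rule measurableI) (use that sets sp in \<open>auto simp: G_def\<close>)
  have [measurable]: "N e (h * real (Suc j)) \<in> measurable (sigma (space M) G) (count_space UNIV)"
    "N e (h * real j) \<in> measurable (sigma (space M) G) (count_space UNIV)"
    using assms by (auto intro!: N)
  have "incr h j e \<in> measurable (sigma (space M) G) (count_space UNIV)"
    unfolding incr_def by measurable
  then have "incr h j e -` A \<inter> space M \<in> sigma_sets (space M) G" for A
    using measurable_sets[of "incr h j e" "sigma (space M) G" "count_space UNIV" A] sets sp by simp
  then show ?thesis by (auto simp: fine_algebra_def Clock G_def)
qed (simp_all add: fine_algebra_def)

text \<open>Two kinds of independence are merged by \<open>indep_sets_refine\<close>: that between
  sources, from the construction, and that between increments of one clock, from the Poisson
  property.\<close>

lemma indep_fine: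
  assumes h: "0 < h"
  shows "indep_sets (\<lambda>(s, j). fine_algebra h s j) (fine_index n)"
  unfolding fine_index_def
proof (rule indep_sets_refine[OF indep Int_stable_source_algebra])
  fix s :: "('v, 'o) source" assume s: "s \<in> sources V E \<E> \<tau>"
  have ev: "source_algebra (space M) (\<zeta> 0) N C s \<subseteq> events"
    using indep s by (auto simp: indep_sets_def)
  have single: "indep_sets F {0}" if "F 0 \<subseteq> events" for F :: "nat \<Rightarrow> 'w set set"
    using that by (intro indep_setsI) (auto simp: subset_singleton_iff)
  show "indep_sets (fine_algebra h s) (case s of Clock e \<Rightarrow> {..<n} | _ \<Rightarrow> {0})"
  proof (cases s)
    case (Clock e)
    then have e: "e \<in> D" using s by (auto simp: sources_def)
    have "strict_mono (\<lambda>i. h * real i)" using h by (auto simp: strict_mono_def)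
    moreover have "\<forall>(m::nat) u. 0 \<le> u 0 \<and> strict_mono u \<longrightarrow>
        indep_vars (\<lambda>_. count_space UNIV) (\<lambda>i \<omega>. N e (u (Suc i)) \<omega> - N e (u i) \<omega>) {..<m}"
      using poisson[OF e] unfolding poisson_process_def by blast
    ultimately have "indep_vars (\<lambda>_. count_space UNIV)
          (\<lambda>i \<omega>. N e (h * real (Suc i)) \<omega> - N e (h * real i) \<omega>) {..<n}"
      by (elim allE[of _ n] allE[of _ "\<lambda>i. h * real i"]) simp
    moreover have "fine_algebra h (Clock e) =
        (\<lambda>i. {(\<lambda>\<omega>. N e (h * real (Suc i)) \<omega> - N e (h * real i) \<omega>) -` A \<inter> space M | A. True})"
      by (rule ext) (simp add: fine_algebra_def incr_def[abs_def])
    ultimately show ?thesis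
      unfolding indep_vars_def2 by (simp add: Clock)
  qed (use ev in \<open>auto intro!: single simp: fine_algebra_def\<close>)
qed (use fine_sub h in auto)

lemma prob_incr:
  assumes "0 < h" "e \<in> D"
  shows "prob {\<omega> \<in> space M. incr h m e \<omega> = d} = pmf (poisson_pmf h) d"
proof -
  have "distr M (count_space UNIV) (\<lambda>\<omega>. N e (h * real (Suc m)) \<omega> - N e (h * real m) \<omega>) =
      measure_pmf (poisson_pmf (1 * (h * real (Suc m) - h * real m)))"
    using poisson[OF assms(2)] assms(1) unfolding poisson_process_def by (auto simp: algebra_simps)
  then have d: "distr M (count_space UNIV) (incr h m e) = measure_pmf (poisson_pmf h)"
    by (simp add: incr_def[abs_def] algebra_simps)
  have [measurable]: "random_variable (count_space UNIV) (incr h m e)"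
  proof -
    have N: "random_variable (count_space UNIV) (N e t)" if "0 \<le> t" for t
      using poisson[OF assms(2)] that unfolding poisson_process_def by blast
    have [measurable]: "random_variable (count_space UNIV) (N e (h * real m))"
      "random_variable (count_space UNIV) (N e (h * real (Suc m)))"
      using assms(1) by (auto intro!: N)
    show ?thesis unfolding incr_def[abs_def] by measurable
  qed
  have "measure (distr M (count_space UNIV) (incr h m e)) {d} = prob (incr h m e -` {d} \<inter> space M)"
    by (subst measure_distr) auto
  also have "incr h m e -` {d} \<inter> space M = {\<omega> \<in> space M. incr h m e \<omega> = d}" by auto
  finally show ?thesis unfolding d by (simp add: measure_pmf_single)
qed

lemma prob_choice:
  assumes "e \<in> D" "a \<in> V" "b \<in> V" "compatible E \<tau> a b" "v \<in> closer_nbrs V E a b"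
  shows "prob {\<omega> \<in> space M. C e k a b \<omega> = v} = 1 / card (closer_nbrs V E a b)"
proof -
  have fin: "finite (closer_nbrs V E a b)" using finV by (simp add: closer_nbrs_def)
  note m = choice_rv[OF assms(1-4), of k]
  have "measure (distr M (count_space (closer_nbrs V E a b)) (C e k a b)) {v} =
      prob (C e k a b -` {v} \<inter> space M)"
    using m assms(5) by (subst measure_distr) auto
  also have "C e k a b -` {v} \<inter> space M = {\<omega> \<in> space M. C e k a b \<omega> = v}" by auto
  finally show ?thesis unfolding choice_distr[OF assms(1-4)]
    using fin assms(5) by (simp add: measure_uniform_count_measure)
qed

text \<open>The fresh sources of step \<open>m\<close> are its increments, one per clock, and the
  choice in question. Their probabilities are h exp(-h) for \<open>e\<close>, exp(-h) for each other
  clock, and the uniform weight of \<open>v\<close>.\<close>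

lemma prob_sole_indep:
  assumes h: "0 < h" and e: "e \<in> D"
    and ab: "a \<in> V" "b \<in> V" "compatible E \<tau> a b" and v: "v \<in> closer_nbrs V E a b"
    and A: "A \<in> sigma_sets (space M) (\<Union>(s, j)\<in>fine_index (Suc m) -
        insert (Choice e k a b, 0) ((\<lambda>e'. (Clock e', m)) ` D). fine_algebra h s j)"
  shows "prob (A \<inter> {\<omega> \<in> space M. sole_ring h m e \<omega> \<and> C e k a b \<omega> = v}) =
     prob A * (h * exp (- h * card D)) / card (closer_nbrs V E a b)"
proof -
  define W where "W = insert (Choice e k a b, 0) ((\<lambda>e'. (Clock e', m)) ` D)"
  define B :: "('v, 'o) source \<times> nat \<Rightarrow> 'w set" where
    "B w = (case fst w of Clock e' \<Rightarrow> {\<omega> \<in> space M. incr h m e' \<omega> = (if e' = e then 1 else 0)}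
      | _ \<Rightarrow> {\<omega> \<in> space M. C e k a b \<omega> = v})" for w
  have 1: "prob (A \<inter> (\<Inter>w\<in>W. B w)) = prob A * (\<Prod>w\<in>W. prob (B w))"
  proof (rule indep_sets_split[OF indep_fine[OF h, of "Suc m"]])
    show "W \<subseteq> fine_index (Suc m)"
      using e ab by (auto simp: W_def fine_index_def sources_def simp del: split_paired_Ex)
    show "finite W" using finD by (simp add: W_def)
    show "A \<in> sigma_sets (space M) (\<Union>i\<in>fine_index (Suc m) - W. case i of (s, j) \<Rightarrow> fine_algebra h s j)"
      using A by (simp add: W_def)
    fix w assume "w \<in> W"
    then consider "w = (Choice e k a b, 0)" | e' where "w = (Clock e', m)" "e' \<in> D"
      by (auto simp: W_def)
    then show "B w \<in> (case w of (s, j) \<Rightarrow> fine_algebra h s j)"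
    proof cases
      case 1
      have "{\<omega> \<in> space M. C e k a b \<omega> = v} = C e k a b -` {v} \<inter> space M" by auto
      then show ?thesis using 1 by (auto simp: B_def fine_algebra_def)
    next
      case 2
      have "{\<omega> \<in> space M. incr h m e' \<omega> = d} = incr h m e' -` {d} \<inter> space M" for d by auto
      then show ?thesis using 2 by (auto simp: B_def fine_algebra_def)
    qed
  qed (use Int_stable_fine in auto)
  have 2: "A \<inter> (\<Inter>w\<in>W. B w) = A \<inter> {\<omega> \<in> space M. sole_ring h m e \<omega> \<and> C e k a b \<omega> = v}"
    using e by (auto simp: W_def B_def sole_ring_def)
  have inj: "inj_on (\<lambda>e'. (Clock e', m)) D" by (auto simp: inj_on_def)
  have "(\<Prod>w\<in>W. prob (B w)) = prob {\<omega> \<in> space M. C e k a b \<omega> = v} *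
      (\<Prod>e'\<in>D. prob {\<omega> \<in> space M. incr h m e' \<omega> = (if e' = e then 1 else 0)})"
    unfolding W_def using finD
    by (subst prod.insert) (auto simp: B_def prod.reindex[OF inj])
  also have "\<dots> = (1 / card (closer_nbrs V E a b)) * (\<Prod>e'\<in>D. if e' = e then h * exp (- h) else exp (- h))"
    using prob_choice[OF e ab v] h
    by (intro arg_cong2[of _ _ _ _ "(*)"] prod.cong) (auto simp: prob_incr)
  also have "(\<Prod>e'\<in>D. if e' = e then h * exp (- h) else exp (- h)) = h * exp (- h * card D)"
  proof -
    have "(\<Prod>e'\<in>D. if e' = e then h * exp (- h) else exp (- h)) =
        (\<Prod>e'\<in>D. (if e' = e then h else 1) * exp (- h))" by (intro prod.cong) auto
    also have "\<dots> = h * exp (- h) ^ card D"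
      using finD e by (simp add: prod.distrib prod.delta)
    finally show ?thesis by (simp add: exp_of_nat2_mult[symmetric])
  qed
  finally show ?thesis using 1 2 by simp
qed

lemma prob_incr_pattern:
  assumes h: "0 < h"
  shows "prob {\<omega> \<in> space M. \<forall>e\<in>D. incr h m e \<omega> = d e} = (\<Prod>e\<in>D. pmf (poisson_pmf h) (d e))"
proof -
  define W :: "(('v, 'o) source \<times> nat) set" where "W = (\<lambda>e'. (Clock e', m)) ` D"
  define B :: "('v, 'o) source \<times> nat \<Rightarrow> 'w set" where
    "B w = (case fst w of Clock e' \<Rightarrow> {\<omega> \<in> space M. incr h m e' \<omega> = d e'} | _ \<Rightarrow> {})" for w
  have 1: "prob (space M \<inter> (\<Inter>w\<in>W. B w)) = prob (space M) * (\<Prod>w\<in>W. prob (B w))"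
  proof (rule indep_sets_split[OF indep_fine[OF h, of "Suc m"]])
    show "W \<subseteq> fine_index (Suc m)" by (auto simp: W_def fine_index_def sources_def)
    show "finite W" using finD by (simp add: W_def)
    show "space M \<in> sigma_sets (space M) (\<Union>i\<in>fine_index (Suc m) - W. case i of (s, j) \<Rightarrow> fine_algebra h s j)"
      by (rule sigma_sets_top)
    fix w assume "w \<in> W"
    then obtain e' where "w = (Clock e', m)" "e' \<in> D" by (auto simp: W_def)
    moreover have "{\<omega> \<in> space M. incr h m e' \<omega> = d e'} = incr h m e' -` {d e'} \<inter> space M" by auto
    ultimately show "B w \<in> (case w of (s, j) \<Rightarrow> fine_algebra h s j)"
      by (auto simp: B_def fine_algebra_def)
  qed (use Int_stable_fine in auto)
  have 2: "space M \<inter> (\<Inter>w\<in>W. B w) = {\<omega> \<in> space M. \<forall>e\<in>D. incr h m e \<omega> = d e}"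
    by (auto simp: W_def B_def)
  have inj: "inj_on (\<lambda>e'. (Clock e', m)) D" by (auto simp: inj_on_def)
  show ?thesis using 1 h unfolding 2
    by (simp add: W_def prod.reindex[OF inj] B_def prob_space prob_incr)
qed

lemma pred_\<zeta>: "0 \<le> t \<Longrightarrow> Measurable.pred M (\<lambda>\<omega>. \<zeta> t \<omega> = \<eta>)"
  using meas_\<zeta> by (rule pred_eq_count_space)

lemma pred_incr:
  assumes "0 \<le> h" "e \<in> D" shows "Measurable.pred M (\<lambda>\<omega>. incr h m e \<omega> = d)"
proof -
  have N: "random_variable (count_space UNIV) (N e t)" if "0 \<le> t" for t
    using poisson[OF assms(2)] that unfolding poisson_process_def by blast
  have [measurable]: "random_variable (count_space UNIV) (N e (h * real m))"
    "random_variable (count_space UNIV) (N e (h * real (Suc m)))"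
    using assms(1) by (auto intro!: N)
  show ?thesis unfolding incr_def[abs_def] by measurable
qed

lemma
  assumes h: "0 \<le> h"
  shows pred_N: "e \<in> D \<Longrightarrow> Measurable.pred M (\<lambda>\<omega>. N e (h * real m) \<omega> = k)"
    and pred_euler_C: "Measurable.pred M (\<lambda>\<omega>. euler C h m \<omega> = \<eta>)"
proof -
  note p = pred_euler[where c = C and P = M and m = m and i = m, OF h refl]
  show "Measurable.pred M (\<lambda>\<omega>. euler C h m \<omega> = \<eta>)"
    by (rule p(2)) (auto intro: C_in_V pred_eq_count_space[OF choice_rv] pred_\<zeta> pred_incr[OF h])
  show "Measurable.pred M (\<lambda>\<omega>. N e (h * real m) \<omega> = k)" if "e \<in> D"
    by (rule p(1)) (auto intro: C_in_V pred_eq_count_space[OF choice_rv] pred_\<zeta> pred_incr[OF h] that)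
qed

lemma pred_sole: "0 \<le> h \<Longrightarrow> Measurable.pred M (\<lambda>\<omega>. sole_ring h m e \<omega>)"
  unfolding sole_ring_def using pred_incr finD by (intro pred_intros_finite) auto

lemma euler_C_in_S: "\<omega> \<in> space M \<Longrightarrow> euler C h m \<omega> \<in> S"
  by (intro euler_in_S C_in_V)

section \<open>Generator of the discretized chain\<close>

definition nbrs :: "('v \<Rightarrow> 'o) \<Rightarrow> 'v \<times> 'v \<Rightarrow> 'o set" where
  "nbrs \<eta> e = (if compatible E \<tau> (\<eta> (fst e)) (\<eta> (snd e))
     then closer_nbrs V E (\<eta> (fst e)) (\<eta> (snd e)) else {})"

text \<open>The infinitesimal generator of the attraction process: every directed edge acts at rate
  one and averages over the admissible new opinions. An incompatible edge contributes an empty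
  sum.\<close>

definition gen :: "(('v \<Rightarrow> 'o) \<Rightarrow> real) \<Rightarrow> ('v \<Rightarrow> 'o) \<Rightarrow> real" where
  "gen f \<eta> = (\<Sum>e\<in>D. \<Sum>v\<in>nbrs \<eta> e. (f (\<eta>(fst e := v)) - f \<eta>) / card (nbrs \<eta> e))"

definition move_event :: "real \<Rightarrow> nat \<Rightarrow> ('v \<Rightarrow> 'o) \<Rightarrow> 'v \<times> 'v \<Rightarrow> 'o \<Rightarrow> 'w set" where
  "move_event h m \<eta> e v = {\<omega> \<in> space M. euler C h m \<omega> = \<eta> \<and> sole_ring h m e \<omega> \<and>
     C e (Suc (N e (h * real m) \<omega>)) (\<eta> (fst e)) (\<eta> (snd e)) \<omega> = v}"

lemma edge_opinions: "e \<in> D \<Longrightarrow> \<eta> \<in> S \<Longrightarrow> \<eta> (fst e) \<in> V \<and> \<eta> (snd e) \<in> V"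
  using dir_edges_mem[OF sg, of "fst e" "snd e"] by (auto simp: PiE_iff)

lemma past_event:
  assumes h: "0 \<le> h" and e: "e \<in> D"
  shows "{\<omega> \<in> space M. euler C h m \<omega> = \<eta> \<and> N e (h * real m) \<omega> = k} \<in>
    sigma_sets (space M) (\<Union>(s, j)\<in>fine_index (Suc m) -
        insert (Choice e (Suc k) a b, 0) ((\<lambda>e'. (Clock e', m)) ` D). fine_algebra h s j)"
    (is "_ \<in> sigma_sets _ ?G")
proof -
  text \<open>Up to the \<open>k\<close>-th activation of \<open>e\<close> the chain cannot have used choice number \<open>k + 1\<close>,
    so that choice may be overwritten by a dummy one.\<close>
  define c where "c e' j a' b' = (if (e', j) = (e, Suc k) then (\<lambda>_. a') else C e' j a' b')" for e' j a' b'
  have "?G \<subseteq> Pow (space M)"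
    using fine_sub[OF h] source_algebra_sub by fast
  then have sets: "sets (sigma (space M) ?G) = sigma_sets (space M) ?G"
    and sp: "space (sigma (space M) ?G) = space M" by auto
  have basic: "Measurable.pred (sigma (space M) ?G) P"
    if "{\<omega> \<in> space M. P \<omega>} \<in> fine_algebra h s j" "(s, j) \<in> fine_index (Suc m)"
      "(s, j) \<notin> insert (Choice e (Suc k) a b, 0) ((\<lambda>e'. (Clock e', m)) ` D)" for P s j
  proof -
    have "{\<omega> \<in> space M. P \<omega>} \<in> sigma_sets (space M) ?G"
      using that by (intro sigma_sets.Basic) blast
    then show ?thesis unfolding pred_def sets sp .
  qed
  note p = pred_euler[where c = c and P = "sigma (space M) ?G" and m = m and i = m, OF h sp]
  \<comment> \<open>The dummy value \<open>a'\<close> lies in the opinion set, so the modified chain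
    stays in the finite set \<open>S\<close>.\<close>
  have 1: "c e' j a' b' \<omega> \<in> V"
    if "e' \<in> D" "a' \<in> V" "b' \<in> V" "compatible E \<tau> a' b'" "\<omega> \<in> space M" for e' j a' b' \<omega>
    using that C_in_V by (auto simp: c_def)
  have 2: "Measurable.pred (sigma (space M) ?G) (\<lambda>\<omega>. c e' j a' b' \<omega> = v)"
    if "e' \<in> D" "a' \<in> V" "b' \<in> V" "compatible E \<tau> a' b'" for e' j a' b' v
  proof (cases "(e', j) = (e, Suc k)")
    case True
    then show ?thesis by (simp add: c_def)
  next
    case False
    have "{\<omega> \<in> space M. C e' j a' b' \<omega> = v} = C e' j a' b' -` {v} \<inter> space M" by auto
    then have "{\<omega> \<in> space M. C e' j a' b' \<omega> = v} \<in> fine_algebra h (Choice e' j a' b') 0"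
      by (auto simp: fine_algebra_def)
    moreover have "(Choice e' j a' b', 0) \<in> fine_index (Suc m)"
      using that unfolding fine_index_def sources_def by (auto simp del: split_paired_Ex)
    ultimately have "Measurable.pred (sigma (space M) ?G) (\<lambda>\<omega>. C e' j a' b' \<omega> = v)"
      using False by (intro basic[of _ "Choice e' j a' b'" 0]) auto
    then show ?thesis using False by (auto simp: c_def)
  qed
  have 3: "Measurable.pred (sigma (space M) ?G) (\<lambda>\<omega>. \<zeta> 0 \<omega> = \<eta>)" for \<eta>
  proof (rule basic)
    have "{\<omega> \<in> space M. \<zeta> 0 \<omega> = \<eta>} = \<zeta> 0 -` {\<eta>} \<inter> space M" by auto
    then show "{\<omega> \<in> space M. \<zeta> 0 \<omega> = \<eta>} \<in> fine_algebra h Initial 0"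
      by (auto simp: fine_algebra_def)
  qed (auto simp: fine_index_def sources_def)
  have 4: "Measurable.pred (sigma (space M) ?G) (\<lambda>\<omega>. incr h i e' \<omega> = d)" if "i < m" "e' \<in> D" for i e' d
  proof (rule basic)
    have "{\<omega> \<in> space M. incr h i e' \<omega> = d} = incr h i e' -` {d} \<inter> space M" by auto
    then show "{\<omega> \<in> space M. incr h i e' \<omega> = d} \<in> fine_algebra h (Clock e') i"
      by (auto simp: fine_algebra_def)
  qed (use that in \<open>auto simp: fine_index_def sources_def\<close>)
  have [measurable]: "Measurable.pred (sigma (space M) ?G) (\<lambda>\<omega>. euler c h m \<omega> = \<eta>)"
    by (rule p(2)[OF 1 2 3 4 order_refl])
  have [measurable]: "Measurable.pred (sigma (space M) ?G) (\<lambda>\<omega>. N e (h * real m) \<omega> = k)"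
    by (rule p(1)[OF 1 2 3 4 order_refl e])
  have "Measurable.pred (sigma (space M) ?G) (\<lambda>\<omega>. euler c h m \<omega> = \<eta> \<and> N e (h * real m) \<omega> = k)"
    by measurable
  then have "{\<omega> \<in> space M. euler c h m \<omega> = \<eta> \<and> N e (h * real m) \<omega> = k} \<in> sigma_sets (space M) ?G"
    unfolding pred_def sets sp .
  moreover have "euler c h m \<omega> = euler C h m \<omega>" if "\<omega> \<in> space M" "N e (h * real m) \<omega> = k" for \<omega>
    by (rule euler_choice_irrelevant[OF h that(1) e, of k]) (use that(2) in \<open>auto simp: c_def fun_eq_iff\<close>)
  then have "{\<omega> \<in> space M. euler c h m \<omega> = \<eta> \<and> N e (h * real m) \<omega> = k} =
      {\<omega> \<in> space M. euler C h m \<omega> = \<eta> \<and> N e (h * real m) \<omega> = k}" by (auto simp del: euler.simps)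
  ultimately show ?thesis by simp
qed

lemma prob_move_event:
  assumes h: "0 < h" and e: "e \<in> D" and \<eta>: "\<eta> \<in> S" and v: "v \<in> nbrs \<eta> e"
  shows "move_event h m \<eta> e v \<in> events"
    and "prob (move_event h m \<eta> e v) =
      prob {\<omega> \<in> space M. euler C h m \<omega> = \<eta>} * (h * exp (- h * card D)) / card (nbrs \<eta> e)"
proof -
  let ?a = "\<eta> (fst e)" and ?b = "\<eta> (snd e)"
  have comp: "compatible E \<tau> ?a ?b" and v': "v \<in> closer_nbrs V E ?a ?b"
    and nb: "nbrs \<eta> e = closer_nbrs V E ?a ?b"
    using v by (auto simp: nbrs_def split: if_splits)
  have ab: "?a \<in> V" "?b \<in> V" using edge_opinions[OF e \<eta>] by auto
  \<comment> \<open>Slicing by the count \<open>k\<close> replaces the randomly indexed choice by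
    the fixed variable \<open>C e (Suc k)\<close>, which is independent of \<open>A k\<close> by
    \<open>past_event\<close>. The factor is the same for all \<open>k\<close>, so the slices add
    up.\<close>
  define A where "A k = {\<omega> \<in> space M. euler C h m \<omega> = \<eta> \<and> N e (h * real m) \<omega> = k}" for k
  define B where "B k = A k \<inter> {\<omega> \<in> space M. sole_ring h m e \<omega> \<and> C e (Suc k) ?a ?b \<omega> = v}" for k
  have h0: "0 \<le> h" using h by simp
  note [measurable] = pred_euler_C[OF h0] pred_N[OF h0 e] pred_sole[OF h0]
    pred_eq_count_space[OF choice_rv[OF e ab comp]]
  have Aev: "A k \<in> events" for k unfolding A_def by measurable
  have Bev: "B k \<in> events" for k unfolding B_def using Aev by measurable
  have UA: "(\<Union>k. A k) = {\<omega> \<in> space M. euler C h m \<omega> = \<eta>}" by (auto simp: A_def)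
  have UB: "(\<Union>k. B k) = move_event h m \<eta> e v" by (auto simp: A_def B_def move_event_def)
  show "move_event h m \<eta> e v \<in> events" unfolding UB[symmetric] using Bev by blast
  have Bk: "prob (B k) = prob (A k) * ((h * exp (- h * card D)) / card (nbrs \<eta> e))" for k
    unfolding B_def nb
    using prob_sole_indep[OF h e ab comp v' past_event[OF h0 e, where \<eta> = \<eta> and k = k]]
    by (simp add: A_def)
  have "(\<lambda>k. prob (A k)) sums prob (\<Union>k. A k)"
    using Aev by (intro finite_measure_UNION) (auto simp: disjoint_family_on_def A_def)
  then have "(\<lambda>k. prob (B k)) sums (prob (\<Union>k. A k) * ((h * exp (- h * card D)) / card (nbrs \<eta> e)))"
    unfolding Bk by (rule sums_mult2)
  moreover have "(\<lambda>k. prob (B k)) sums prob (\<Union>k. B k)"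
    using Bev by (intro finite_measure_UNION) (auto simp: disjoint_family_on_def A_def B_def)
  ultimately have "prob (\<Union>k. B k) = prob (\<Union>k. A k) * ((h * exp (- h * card D)) / card (nbrs \<eta> e))"
    by (rule sums_unique2[symmetric])
  then show "prob (move_event h m \<eta> e v) =
      prob {\<omega> \<in> space M. euler C h m \<omega> = \<eta>} * (h * exp (- h * card D)) / card (nbrs \<eta> e)"
    unfolding UA UB by simp
qed

lemma finite_nbrs: "finite (nbrs \<eta> e)"
  using finV by (auto simp: nbrs_def closer_nbrs_def)

text \<open>At most one of the events \<open>move_event\<close> occurs, that of the actual
  configuration, the sole ringing edge and the opinion drawn, so the sum is the increment of
  \<open>f\<close>. Linearity of expectation can then replace conditional expectations.\<close>

lemma euler_step_decomposition:
  fixes f :: "('v \<Rightarrow> 'o) \<Rightarrow> real"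
  assumes h: "0 \<le> h" and \<omega>: "\<omega> \<in> space M"
  shows "f (euler C h (Suc m) \<omega>) = f (euler C h m \<omega>) +
    (\<Sum>\<eta>\<in>S. \<Sum>e\<in>D. \<Sum>v\<in>nbrs \<eta> e. (f (\<eta>(fst e := v)) - f \<eta>) * indicator (move_event h m \<eta> e v) \<omega>)"
    (is "_ = _ + ?sum")
proof (cases "\<exists>e\<in>D. sole_ring h m e \<omega>")
  case False
  then have "?sum = 0"
    by (intro sum.neutral ballI) (auto simp: move_event_def indicator_def)
  then show ?thesis using False by simp
next
  case True
  then obtain e0 where e0: "e0 \<in> D" "sole_ring h m e0 \<omega>" by blast
  define \<eta>0 where "\<eta>0 = euler C h m \<omega>"
  define v0 where "v0 = C e0 (Suc (N e0 (h * real m) \<omega>)) (\<eta>0 (fst e0)) (\<eta>0 (snd e0)) \<omega>"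
  have \<eta>0: "\<eta>0 \<in> S" unfolding \<eta>0_def by (rule euler_C_in_S[OF \<omega>])
  have N: "N e0 (h * real (Suc m)) \<omega> = Suc (N e0 (h * real m) \<omega>)"
    using N_Suc_incr[OF h e0(1) \<omega>, of m] e0 by (simp add: sole_ring_def)
  have eul: "euler C h (Suc m) \<omega> =
      (if compatible E \<tau> (\<eta>0 (fst e0)) (\<eta>0 (snd e0)) then \<eta>0(fst e0 := v0) else \<eta>0)"
    unfolding euler_sole[OF e0] N update_def v0_def \<eta>0_def ..
  have ind: "indicator (move_event h m \<eta> e v) \<omega> = (if \<eta> = \<eta>0 then if e = e0 then if v = v0 then 1 else 0 else 0 else (0::real))"
    if "e \<in> D" for \<eta> e v
  proof (cases "e = e0")
    case True
    have "\<omega> \<in> move_event h m \<eta> e v \<longleftrightarrow> \<eta> = \<eta>0 \<and> v = v0"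
      unfolding move_event_def True \<eta>0_def v0_def using e0 \<omega> by blast
    then show ?thesis using True by (simp add: indicator_def)
  next
    case False
    then have "\<omega> \<notin> move_event h m \<eta> e v"
      using sole_ring_unique[OF e0(1) that e0(2)] by (auto simp: move_event_def)
    then show ?thesis using False by simp
  qed
  have "?sum = (\<Sum>\<eta>\<in>S. \<Sum>e\<in>D. \<Sum>v\<in>nbrs \<eta> e.
      if \<eta> = \<eta>0 then if e = e0 then if v = v0 then f (\<eta>(fst e := v)) - f \<eta> else 0 else 0 else 0)"
    by (intro sum.cong refl) (simp add: ind)
  also have "\<dots> = (\<Sum>\<eta>\<in>S. if \<eta> = \<eta>0 then \<Sum>e\<in>D. if e = e0 then \<Sum>v\<in>nbrs \<eta> e.
      if v = v0 then f (\<eta>(fst e := v)) - f \<eta> else 0 else 0 else 0)"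
    by (intro sum.cong refl if_weak_cong) (auto intro!: sum.cong)
  also have "\<dots> = (\<Sum>v\<in>nbrs \<eta>0 e0. if v = v0 then f (\<eta>0(fst e0 := v)) - f \<eta>0 else 0)"
    using \<eta>0 e0 finS finD by simp
  also have "\<dots> = (if v0 \<in> nbrs \<eta>0 e0 then f (\<eta>0(fst e0 := v0)) - f \<eta>0 else 0)"
    using finite_nbrs by simp
  finally have sum: "?sum = \<dots>" .
  have "v0 \<in> nbrs \<eta>0 e0 \<longleftrightarrow> compatible E \<tau> (\<eta>0 (fst e0)) (\<eta>0 (snd e0))"
    using C_in[OF e0(1) _ _ _ \<omega>] edge_opinions[OF e0(1) \<eta>0] by (auto simp: nbrs_def v0_def)
  then show ?thesis unfolding eul sum unfolding \<eta>0_def by simp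
qed

text \<open>A discrete Dynkin formula without remainder. The factor
  \<open>h * exp (- h * card D)\<close> is the probability that a given edge is the only one to
  ring, and rings once.\<close>

lemma expectation_euler_Suc:
  fixes f :: "('v \<Rightarrow> 'o) \<Rightarrow> real"
  assumes h: "0 < h"
  shows "expectation (\<lambda>\<omega>. f (euler C h (Suc m) \<omega>)) =
    expectation (\<lambda>\<omega>. f (euler C h m \<omega>)) +
    h * exp (- h * card D) * expectation (\<lambda>\<omega>. gen f (euler C h m \<omega>))"
proof -
  have h0: "0 \<le> h" using h by simp
  define T where "T \<eta> e v \<omega> = (f (\<eta>(fst e := v)) - f \<eta>) * indicator (move_event h m \<eta> e v) \<omega>" for \<eta> e v \<omega>
  have int: "integrable M (T \<eta> e v)" and exT: "expectation (T \<eta> e v) = prob {\<omega> \<in> space M. euler C h m \<omega> = \<eta>} *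
      (h * exp (- h * card D) * ((f (\<eta>(fst e := v)) - f \<eta>) / card (nbrs \<eta> e)))"
    if "\<eta> \<in> S" "e \<in> D" "v \<in> nbrs \<eta> e" for \<eta> e v
    using prob_move_event[OF h that(2,1,3), of m] unfolding T_def
    by (auto intro!: integrable_mult_right integrable_real_indicator simp: emeasure_eq_measure)
  note fv = expectation_finite_valued[OF finS euler_C_in_S pred_euler_C[OF h0]]
  have int2: "integrable M (\<lambda>\<omega>. \<Sum>\<eta>\<in>S. \<Sum>e\<in>D. \<Sum>v\<in>nbrs \<eta> e. T \<eta> e v \<omega>)"
    by (intro Bochner_Integration.integrable_sum int)
  have "expectation (\<lambda>\<omega>. f (euler C h (Suc m) \<omega>)) =
      expectation (\<lambda>\<omega>. f (euler C h m \<omega>) + (\<Sum>\<eta>\<in>S. \<Sum>e\<in>D. \<Sum>v\<in>nbrs \<eta> e. T \<eta> e v \<omega>))"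
    unfolding T_def by (intro Bochner_Integration.integral_cong refl euler_step_decomposition h0)
  also have "\<dots> = expectation (\<lambda>\<omega>. f (euler C h m \<omega>)) +
      expectation (\<lambda>\<omega>. \<Sum>\<eta>\<in>S. \<Sum>e\<in>D. \<Sum>v\<in>nbrs \<eta> e. T \<eta> e v \<omega>)"
    by (intro Bochner_Integration.integral_add fv(1) int2)
  also have "expectation (\<lambda>\<omega>. \<Sum>\<eta>\<in>S. \<Sum>e\<in>D. \<Sum>v\<in>nbrs \<eta> e. T \<eta> e v \<omega>) =
      (\<Sum>\<eta>\<in>S. \<Sum>e\<in>D. \<Sum>v\<in>nbrs \<eta> e. expectation (T \<eta> e v))"
    using int by (simp add: Bochner_Integration.integral_sum Bochner_Integration.integrable_sum)
  also have "\<dots> = (\<Sum>\<eta>\<in>S. h * exp (- h * card D) * (prob {\<omega> \<in> space M. euler C h m \<omega> = \<eta>} * gen f \<eta>))"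
    unfolding gen_def sum_distrib_left by (intro sum.cong refl) (simp add: exT algebra_simps)
  also have "\<dots> = h * exp (- h * card D) * expectation (\<lambda>\<omega>. gen f (euler C h m \<omega>))"
    using fv(2)[where g = "gen f"] by (simp add: sum_distrib_left)
  finally show ?thesis .
qed

subsection \<open>Discretization error and long-time behaviour\<close>

definition good_step :: "real \<Rightarrow> nat \<Rightarrow> 'w \<Rightarrow> bool" where
  "good_step h m \<omega> \<longleftrightarrow> (\<forall>e\<in>D. incr h m e \<omega> = 0) \<or> (\<exists>e\<in>D. sole_ring h m e \<omega>)"

lemma euler_eq_\<zeta>:
  assumes wd: "well_driven \<omega>" and \<omega>: "\<omega> \<in> space M" and h: "0 \<le> h"
    and good: "\<And>i. i < m \<Longrightarrow> good_step h i \<omega>"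
  shows "euler C h m \<omega> = \<zeta> (h * real m) \<omega>"
  using good
proof (induction m)
  case (Suc m)
  then have IH: "euler C h m \<omega> = \<zeta> (h * real m) \<omega>" by simp
  have st: "0 \<le> h * real m" "h * real m \<le> h * real (Suc m)"
    using h by (auto intro!: mult_left_mono)
  show ?case
  proof (cases "\<exists>e\<in>D. sole_ring h m e \<omega>")
    case True
    then obtain e where e: "e \<in> D" "sole_ring h m e \<omega>" by blast
    have "\<zeta> (h * real (Suc m)) \<omega> = update C e (N e (h * real (Suc m)) \<omega>) (\<zeta> (h * real m) \<omega>) \<omega>"
    proof (rule update_of_single_ring[OF wd \<omega> st e(1)])
      show "N e (h * real (Suc m)) \<omega> = Suc (N e (h * real m) \<omega>)"
        using N_Suc_incr[OF h e(1) \<omega>, of m] e by (simp add: sole_ring_def)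
      show "N e' (h * real (Suc m)) \<omega> = N e' (h * real m) \<omega>" if "e' \<in> D" "e' \<noteq> e" for e'
        using N_Suc_incr[OF h that(1) \<omega>, of m] e that by (simp add: sole_ring_def)
    qed
    then show ?thesis unfolding euler_sole[OF e] IH by simp
  next
    case False
    with Suc.prems[of m] have zero: "incr h m e \<omega> = 0" if "e \<in> D" for e
      using that by (auto simp: good_step_def)
    have "\<zeta> (h * real (Suc m)) \<omega> = \<zeta> (h * real m) \<omega>"
    proof (rule constant_while_blocked[OF wd \<omega> st])
      fix e u assume u: "e \<in> D" "h * real m < u" "u \<le> h * real (Suc m)" "rings (N e) u \<omega>"
      have "N e (h * real (Suc m)) \<omega> = N e (h * real m) \<omega>"
        using N_Suc_incr[OF h u(1) \<omega>, of m] zero[OF u(1)] by simp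
      with no_ring[OF u(1) \<omega> st(1) u(2,3)] u(4)
      show "\<not> compatible E \<tau> (\<zeta> (h * real m) \<omega> (fst e)) (\<zeta> (h * real m) \<omega> (snd e))" by blast
    qed
    then show ?thesis using False IH by simp
  qed
qed simp

lemma pred_good_step: "0 \<le> h \<Longrightarrow> Measurable.pred M (\<lambda>\<omega>. good_step h m \<omega>)"
  unfolding good_step_def
  by (intro pred_intros_logic pred_intros_finite finD pred_incr pred_sole)

text \<open>The quadratic order matters: summed over t / h steps the error is still of order h. The
  number of activations in a step is Poisson with mean x = \<open>h * card D\<close>, so a step is
  good with probability (1 + x) exp(-x).\<close>

lemma prob_bad_step:
  assumes h: "0 < h"
  shows "prob {\<omega> \<in> space M. \<not> good_step h m \<omega>} \<le> (h * card D)\<^sup>2"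
proof -
  have h0: "0 \<le> h" using h by simp
  define Z where "Z = {\<omega> \<in> space M. \<forall>e\<in>D. incr h m e \<omega> = 0}"
  define R where "R e = {\<omega> \<in> space M. sole_ring h m e \<omega>}" for e
  have Zev: "Z \<in> events"
    unfolding Z_def using pred_incr[OF h0] finD by (simp add: pred_def[symmetric] pred_intros_finite)
  have Rev: "R e \<in> events" for e unfolding R_def using pred_sole[OF h0] by (simp add: pred_def)
  have pZ: "prob Z = exp (- h * card D)"
    unfolding Z_def prob_incr_pattern[OF h] using h
    by (simp add: exp_of_nat2_mult[symmetric])
  have pR: "prob (R e) = h * exp (- h * card D)" if e: "e \<in> D" for e
  proof -
    have "prob (R e) = (\<Prod>e'\<in>D. pmf (poisson_pmf h) (if e' = e then 1 else 0))"
      unfolding R_def sole_ring_def prob_incr_pattern[OF h] ..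
    also have "\<dots> = (\<Prod>e'\<in>D. (if e' = e then h else 1) * exp (- h))"
      using h by (intro prod.cong) auto
    also have "\<dots> = h * exp (- h) ^ card D"
      using finD e by (simp add: prod.distrib prod.delta)
    finally show ?thesis by (simp add: exp_of_nat2_mult[symmetric])
  qed
  have "prob (\<Union>e\<in>D. R e) = (\<Sum>e\<in>D. prob (R e))"
    using finD Rev sole_ring_unique
    by (intro finite_measure_finite_Union) (auto simp: disjoint_family_on_def R_def)
  then have pUR: "prob (\<Union>e\<in>D. R e) = card D * (h * exp (- h * card D))"
    using pR by simp
  have "prob (Z \<union> (\<Union>e\<in>D. R e)) = prob Z + prob (\<Union>e\<in>D. R e)"
  proof (rule finite_measure_Union[OF Zev])
    show "(\<Union>e\<in>D. R e) \<in> events" using Rev finD by blast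
    have "incr h m e \<omega> = 1" if "e \<in> D" "\<omega> \<in> R e" for e \<omega>
      using that by (simp add: R_def sole_ring_def)
    then show "Z \<inter> (\<Union>e\<in>D. R e) = {}" unfolding Z_def by fastforce
  qed
  moreover have "{\<omega> \<in> space M. \<not> good_step h m \<omega>} = space M - (Z \<union> (\<Union>e\<in>D. R e))"
    unfolding good_step_def Z_def R_def by blast
  moreover have "Z \<union> (\<Union>e\<in>D. R e) \<in> events" using Zev Rev finD by (intro sets.Un sets.finite_UN)
  ultimately have "prob {\<omega> \<in> space M. \<not> good_step h m \<omega>} = 1 - (1 + h * card D) * exp (- (h * card D))"
    using pZ pUR by (simp add: prob_compl algebra_simps)
  \<comment> \<open>With x = \<open>h * card D\<close>, exp(-x) is at least 1 - x, and (1 + x)(1 -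
    x) = 1 - x^2.\<close>
  also have "\<dots> \<le> 1 - (1 + h * card D) * (1 - h * card D)"
    using h exp_ge_add_one_self[of "- (h * card D)"] by (intro diff_left_mono mult_left_mono) auto
  also have "\<dots> = (h * card D)\<^sup>2" by (simp add: power2_eq_square algebra_simps)
  finally show ?thesis .
qed

lemma pred_euler_neq:
  assumes "0 \<le> h" "0 \<le> t"
  shows "Measurable.pred M (\<lambda>\<omega>. euler C h m \<omega> \<noteq> \<zeta> t \<omega>)"
proof -
  note [measurable] = pred_euler_C[OF assms(1)] pred_\<zeta>[OF assms(2)]
  have "Measurable.pred M (\<lambda>\<omega>. \<not> (\<exists>\<eta>\<in>S. euler C h m \<omega> = \<eta> \<and> \<zeta> t \<omega> = \<eta>))"
    using finS by measurable
  moreover have "euler C h m \<omega> \<noteq> \<zeta> t \<omega> \<longleftrightarrow> \<not> (\<exists>\<eta>\<in>S. euler C h m \<omega> = \<eta> \<and> \<zeta> t \<omega> = \<eta>)"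
    if "\<omega> \<in> space M" for \<omega>
    using euler_C_in_S[OF that, of h m] by metis
  ultimately show ?thesis by (subst measurable_cong) assumption
qed

lemma prob_euler_neq_\<zeta>:
  assumes t: "0 < t" and n: "0 < n"
  shows "prob {\<omega> \<in> space M. euler C (t / real n) n \<omega> \<noteq> \<zeta> t \<omega>} \<le> (t * card D)\<^sup>2 / real n"
proof -
  define h where "h = t / real n"
  have h: "0 < h" "h * real n = t" using t n by (auto simp: h_def)
  have h0: "0 \<le> h" using h by simp
  define B where "B m = {\<omega> \<in> space M. \<not> good_step h m \<omega>}" for m
  have Bev: "B m \<in> events" for m
    unfolding B_def using pred_good_step[OF h0, of m] by (simp add: pred_def)
  have "prob {\<omega> \<in> space M. euler C h n \<omega> \<noteq> \<zeta> t \<omega>} \<le> prob (\<Union>m<n. B m)"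
  proof (rule finite_measure_mono_AE)
    \<comment> \<open>In the absence of bad steps \<open>euler_eq_\<zeta>\<close> gives equality on
      \<open>well_driven\<close> paths, hence a comparison of events up to a null set.\<close>
    show "AE \<omega> in M. \<omega> \<in> {\<omega> \<in> space M. euler C h n \<omega> \<noteq> \<zeta> t \<omega>} \<longrightarrow> \<omega> \<in> (\<Union>m<n. B m)"
      using AE_well_driven AE_space
    proof eventually_elim
      case (elim \<omega>)
      then show ?case using euler_eq_\<zeta>[OF elim h0, of n] h(2) by (auto simp: B_def)
    qed
  qed (use Bev in auto)
  also have "\<dots> \<le> (\<Sum>m<n. prob (B m))"
    using Bev by (intro finite_measure_subadditive_finite) auto
  also have "\<dots> \<le> (\<Sum>m<n. (h * card D)\<^sup>2)"
    unfolding B_def by (intro sum_mono prob_bad_step h)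
  also have "\<dots> = (t * card D)\<^sup>2 / real n"
    using n by (simp add: h_def power2_eq_square)
  finally show ?thesis by (simp add: h_def)
qed

section \<open>Drift inequalities transferred to the process\<close>

lemma expectation_nonincreasing:
  fixes f :: "('v \<Rightarrow> 'o) \<Rightarrow> real"
  assumes t: "0 < t" and gen: "\<And>\<eta>. \<eta> \<in> S \<Longrightarrow> gen f \<eta> \<le> 0"
  shows "expectation (\<lambda>\<omega>. f (\<zeta> t \<omega>)) \<le> expectation (\<lambda>\<omega>. f (\<zeta> 0 \<omega>))"
proof -
  \<comment> \<open>A crude bound for \<open>f\<close> on the finite set \<open>S\<close>: replacing
    the process by the chain costs at most \<open>2 * B\<close> on the event where they differ. For
    fixed \<open>t\<close> this error vanishes as the number of steps \<open>n\<close>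
    grows.\<close>
  define B where "B = (\<Sum>\<eta>\<in>S. \<bar>f \<eta>\<bar>)"
  have B: "\<bar>f \<eta>\<bar> \<le> B" if "\<eta> \<in> S" for \<eta>
    unfolding B_def using finS that by (intro member_le_sum) auto
  have B0: "0 \<le> B" unfolding B_def by (intro sum_nonneg) auto
  have ineq: "expectation (\<lambda>\<omega>. f (\<zeta> t \<omega>)) \<le>
      expectation (\<lambda>\<omega>. f (\<zeta> 0 \<omega>)) + 2 * B * ((t * card D)\<^sup>2 / real n)" if n: "0 < n" for n
  proof -
    define h where "h = t / real n"
    have h: "0 < h" using t n by (simp add: h_def)
    then have h0: "0 \<le> h" by simp
    have "expectation (\<lambda>\<omega>. f (euler C h m \<omega>)) \<le> expectation (\<lambda>\<omega>. f (\<zeta> 0 \<omega>))" for m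
    proof (induction m)
      case (Suc m)
      have "expectation (\<lambda>\<omega>. gen f (euler C h m \<omega>)) \<le> 0"
      proof -
        have "expectation (\<lambda>\<omega>. gen f (euler C h m \<omega>)) \<le> expectation (\<lambda>\<omega>. 0)"
          using gen euler_C_in_S
          by (intro integral_mono expectation_finite_valued(1)[OF finS euler_C_in_S pred_euler_C[OF h0]]) auto
        then show ?thesis by simp
      qed
      then have "h * exp (- h * card D) * expectation (\<lambda>\<omega>. gen f (euler C h m \<omega>)) \<le> 0"
        using h by (intro mult_nonneg_nonpos) auto
      then show ?case using Suc expectation_euler_Suc[OF h, of f m] by linarith
    qed simp
    note this[of n]
    moreover have "expectation (\<lambda>\<omega>. f (\<zeta> t \<omega>)) \<le>
        expectation (\<lambda>\<omega>. f (euler C h n \<omega>)) + 2 * B * prob {\<omega> \<in> space M. euler C h n \<omega> \<noteq> \<zeta> t \<omega>}"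
    proof -
      let ?A = "{\<omega> \<in> space M. euler C h n \<omega> \<noteq> \<zeta> t \<omega>}"
      have A: "?A \<in> events" using pred_euler_neq[OF h0, of t n] t by (simp add: pred_def)
      have i1: "integrable M (\<lambda>\<omega>. f (\<zeta> t \<omega>))"
        by (rule expectation_finite_valued(1)[OF finS \<zeta>_in_S pred_\<zeta>]) (use t in auto)
      have i2: "integrable M (\<lambda>\<omega>. f (euler C h n \<omega>))"
        by (rule expectation_finite_valued(1)[OF finS euler_C_in_S pred_euler_C[OF h0]])
      have i3: "integrable M (\<lambda>\<omega>. 2 * B * indicator ?A \<omega>)"
        using A by (intro integrable_mult_right integrable_real_indicator) (auto simp: emeasure_eq_measure)
      have "expectation (\<lambda>\<omega>. f (\<zeta> t \<omega>)) \<le>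
          expectation (\<lambda>\<omega>. f (euler C h n \<omega>) + 2 * B * indicator ?A \<omega>)"
      proof (rule integral_mono[OF i1 Bochner_Integration.integrable_add[OF i2 i3]])
        fix \<omega> assume \<omega>: "\<omega> \<in> space M"
        have "\<bar>f (\<zeta> t \<omega>)\<bar> \<le> B" "\<bar>f (euler C h n \<omega>)\<bar> \<le> B"
          using \<omega> t by (auto intro!: B \<zeta>_in_S euler_C_in_S)
        then show "f (\<zeta> t \<omega>) \<le> f (euler C h n \<omega>) + 2 * B * indicator ?A \<omega>"
          using \<omega> by (auto simp: indicator_def)
      qed
      also have "\<dots> = expectation (\<lambda>\<omega>. f (euler C h n \<omega>)) + expectation (\<lambda>\<omega>. 2 * B * indicator ?A \<omega>)"
        by (rule Bochner_Integration.integral_add[OF i2 i3])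
      also have "expectation (\<lambda>\<omega>. 2 * B * indicator ?A \<omega>) = 2 * B * prob ?A"
        using A by simp
      finally show ?thesis .
    qed
    moreover have "2 * B * prob {\<omega> \<in> space M. euler C h n \<omega> \<noteq> \<zeta> t \<omega>} \<le> 2 * B * ((t * card D)\<^sup>2 / real n)"
      using prob_euler_neq_\<zeta>[OF t n] B0 unfolding h_def by (intro mult_left_mono) auto
    ultimately show ?thesis by linarith
  qed
  have "(\<lambda>n. expectation (\<lambda>\<omega>. f (\<zeta> 0 \<omega>)) + 2 * B * ((t * card D)\<^sup>2 / real n))
      \<longlonglongrightarrow> expectation (\<lambda>\<omega>. f (\<zeta> 0 \<omega>)) + 2 * B * 0"
    by (intro tendsto_intros tendsto_divide_0[OF tendsto_const] filterlim_at_top_imp_at_infinity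
        filterlim_real_sequentially)
  then have "expectation (\<lambda>\<omega>. f (\<zeta> t \<omega>)) \<le> expectation (\<lambda>\<omega>. f (\<zeta> 0 \<omega>)) + 2 * B * 0"
    by (rule LIMSEQ_le_const) (use ineq in \<open>auto intro!: exI[of _ 1]\<close>)
  then show ?thesis by simp
qed

text \<open>In expectation \<open>f\<close> gains at least one unit per unit of time until
  absorption but never exceeds \<open>B\<close>, so the mean time spent outside absorbing
  configurations is at most \<open>B\<close>. Up to time \<open>t\<close> that mean is at least
  \<open>t\<close> times the probability of not being absorbed at \<open>t\<close>.\<close>

lemma prob_not_absorbing:
  fixes f :: "('v \<Rightarrow> 'o) \<Rightarrow> real"
  assumes t: "0 < t" and f: "\<And>\<eta>. \<eta> \<in> S \<Longrightarrow> 0 \<le> f \<eta>" "\<And>\<eta>. \<eta> \<in> S \<Longrightarrow> f \<eta> \<le> B"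
    and gen: "\<And>\<eta>. \<eta> \<in> S \<Longrightarrow> (if absorbing \<eta> then 0 else 1) \<le> gen f \<eta>"
  shows "t * prob {\<omega> \<in> space M. \<not> absorbing (\<zeta> t \<omega>)} \<le> B"
proof -
  define P where "P = prob {\<omega> \<in> space M. \<not> absorbing (\<zeta> t \<omega>)}"
  \<comment> \<open>The exponential comes from the one-step probability of the chain multiplied by
    \<open>n\<close> steps, the subtracted term from the event where chain and process differ; both
    corrections vanish as \<open>n\<close> grows.\<close>
  have ineq: "t * exp (- t * card D / real n) * (P - (t * card D)\<^sup>2 / real n) \<le> B" if n: "0 < n" for n
  proof -
    define h where "h = t / real n"
    have h: "0 < h" using t n by (simp add: h_def)
    then have h0: "0 \<le> h" by simp
    define p where "p = h * exp (- h * card D)"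
    have p0: "0 \<le> p" using h by (simp add: p_def)
    define A where "A m = {\<omega> \<in> space M. \<not> absorbing (euler C h m \<omega>)}" for m
    have Aev: "A m \<in> events" for m
    proof -
      note [measurable] = pred_euler_C[OF h0]
      have "Measurable.pred M (\<lambda>\<omega>. \<exists>\<eta>\<in>S. euler C h m \<omega> = \<eta> \<and> \<not> absorbing \<eta>)"
        using finS by measurable
      then have "{\<omega> \<in> space M. \<exists>\<eta>\<in>S. euler C h m \<omega> = \<eta> \<and> \<not> absorbing \<eta>} \<in> events" by (simp add: pred_def)
      also have "{\<omega> \<in> space M. \<exists>\<eta>\<in>S. euler C h m \<omega> = \<eta> \<and> \<not> absorbing \<eta>} = A m"
        unfolding A_def using euler_C_in_S by blast
      finally show ?thesis .
    qed
    have "A (Suc m) \<subseteq> A m" for m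
    proof
      fix \<omega> assume \<omega>: "\<omega> \<in> A (Suc m)"
      show "\<omega> \<in> A m"
      proof (rule ccontr)
        assume "\<omega> \<notin> A m"
        with \<omega> have ab: "absorbing (euler C h m \<omega>)" by (auto simp: A_def)
        then have upd: "update C e k (euler C h m \<omega>) \<omega> = euler C h m \<omega>" if "e \<in> D" for e k
          using that by (auto simp: absorbing_def update_def)
        have "euler C h (Suc m) \<omega> = euler C h m \<omega>"
        proof (cases "\<exists>e\<in>D. sole_ring h m e \<omega>")
          case True
          then obtain e where e: "e \<in> D" "sole_ring h m e \<omega>" by blast
          show ?thesis unfolding euler_sole[OF e] by (rule upd[OF e(1)])
        qed simp
        with ab \<omega> show False by (simp add: A_def del: euler.simps)
      qed
    qed
    \<comment> \<open>A chain unabsorbed after \<open>n\<close> steps was unabsorbed throughout, so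
      each of the \<open>n\<close> gains is at least \<open>p * prob (A n)\<close>.\<close>
    then have dec: "A n \<subseteq> A m" if "m \<le> n" for m by (rule lift_Suc_antimono_le) (rule that)
    have step: "expectation (\<lambda>\<omega>. f (euler C h m \<omega>)) + p * prob (A m) \<le>
        expectation (\<lambda>\<omega>. f (euler C h (Suc m) \<omega>))" for m
    proof -
      have "prob (A m) = expectation (indicator (A m))" using Aev by simp
      also have "\<dots> \<le> expectation (\<lambda>\<omega>. gen f (euler C h m \<omega>))"
      proof (rule integral_mono)
        show "integrable M (indicat_real (A m))"
          using Aev by (intro integrable_real_indicator) (auto simp: emeasure_eq_measure)
        show "integrable M (\<lambda>\<omega>. gen f (euler C h m \<omega>))"
          by (rule expectation_finite_valued(1)[OF finS euler_C_in_S pred_euler_C[OF h0]])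
        show "indicat_real (A m) \<omega> \<le> gen f (euler C h m \<omega>)" if "\<omega> \<in> space M" for \<omega>
          using gen[OF euler_C_in_S[OF that, of h m]] that by (auto simp: A_def indicator_def split: if_splits)
      qed
      finally have "p * prob (A m) \<le> p * expectation (\<lambda>\<omega>. gen f (euler C h m \<omega>))"
        using p0 by (rule mult_left_mono)
      then show ?thesis using expectation_euler_Suc[OF h, of f m] by (simp add: p_def)
    qed
    have "real m * (p * prob (A n)) \<le> expectation (\<lambda>\<omega>. f (euler C h m \<omega>))" if "m \<le> n" for m
      using that
    proof (induction m)
      case 0
      have "0 \<le> expectation (\<lambda>\<omega>. f (\<zeta> 0 \<omega>))"
        by (rule integral_nonneg_AE) (use f \<zeta>_in_S[of 0] in auto)
      then show ?case by simp
    next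
      case (Suc m)
      have "p * prob (A n) \<le> p * prob (A m)"
        using Suc.prems Aev p0 by (intro mult_left_mono finite_measure_mono dec) auto
      then show ?case using Suc step[of m] by (simp add: algebra_simps)
    qed
    from this[of n] have "real n * (p * prob (A n)) \<le> expectation (\<lambda>\<omega>. f (euler C h n \<omega>))" by simp
    also have "\<dots> \<le> expectation (\<lambda>\<omega>. B)"
      by (rule integral_mono)
         (use f euler_C_in_S expectation_finite_valued(1)[OF finS euler_C_in_S pred_euler_C[OF h0]] in auto)
    also have "\<dots> = B" by (simp add: prob_space)
    finally have 1: "real n * (p * prob (A n)) \<le> B" .
    have neq: "{\<omega> \<in> space M. euler C h n \<omega> \<noteq> \<zeta> t \<omega>} \<in> events"
      using pred_euler_neq[OF h0, of t n] t by (simp add: pred_def)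
    have "P \<le> prob (A n \<union> {\<omega> \<in> space M. euler C h n \<omega> \<noteq> \<zeta> t \<omega>})"
      unfolding P_def using Aev neq by (intro finite_measure_mono) (auto simp: A_def)
    also have "\<dots> \<le> prob (A n) + prob {\<omega> \<in> space M. euler C h n \<omega> \<noteq> \<zeta> t \<omega>}"
      using Aev neq by (rule measure_Un_le)
    also have "\<dots> \<le> prob (A n) + (t * card D)\<^sup>2 / real n"
      using prob_euler_neq_\<zeta>[OF t n] by (simp add: h_def)
    finally have 2: "P - (t * card D)\<^sup>2 / real n \<le> prob (A n)" by simp
    have np: "real n * p = t * exp (- t * card D / real n)"
      using n by (simp add: p_def h_def)
    have "t * exp (- t * card D / real n) * (P - (t * card D)\<^sup>2 / real n) \<le>
        t * exp (- t * card D / real n) * prob (A n)"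
      using t 2 by (intro mult_left_mono) auto
    also have "\<dots> \<le> B" using 1 unfolding np[symmetric] by (simp only: mult.assoc)
    finally show ?thesis .
  qed
  have "(\<lambda>n. t * exp (- t * card D / real n) * (P - (t * card D)\<^sup>2 / real n))
      \<longlonglongrightarrow> t * exp 0 * (P - 0)"
    by (intro tendsto_intros tendsto_divide_0[OF tendsto_const] filterlim_at_top_imp_at_infinity
        filterlim_real_sequentially)
  then have "t * exp 0 * (P - 0) \<le> B"
    by (rule LIMSEQ_le_const2) (use ineq in \<open>auto intro!: exI[of _ 1]\<close>)
  then show ?thesis by (simp add: P_def)
qed

section \<open>Fixation and consensus as events\<close>

lemma fixates_event: "{\<omega> \<in> space M. fixates_to_constant V \<V> \<zeta> \<omega>} \<in> events"
proof -
  have q: "Measurable.pred M (\<lambda>\<omega>. real n \<le> of_rat q \<longrightarrow> \<zeta> (of_rat q) \<omega> = \<eta>)"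
    for n :: nat and q :: rat and \<eta>
  proof (cases "real n \<le> of_rat q")
    case True
    then have "0 \<le> (of_rat q :: real)" by linarith
    then show ?thesis using pred_\<zeta>[of "of_rat q" \<eta>] by simp
  qed simp
  have "Measurable.pred M (\<lambda>\<omega>. \<exists>n::nat. \<exists>c\<in>V. \<forall>q::rat. real n \<le> of_rat q \<longrightarrow>
      \<zeta> (of_rat q) \<omega> = (\<lambda>x\<in>\<V>. c))"
    by (intro pred_intros_countable pred_intros_finite finV q)
  then have "{\<omega> \<in> space M. \<exists>n::nat. \<exists>c\<in>V. \<forall>q::rat. real n \<le> of_rat q \<longrightarrow>
      \<zeta> (of_rat q) \<omega> = (\<lambda>x\<in>\<V>. c)} \<in> events" by (simp add: pred_def)
  also have "{\<omega> \<in> space M. \<exists>n::nat. \<exists>c\<in>V. \<forall>q::rat. real n \<le> of_rat q \<longrightarrow>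
      \<zeta> (of_rat q) \<omega> = (\<lambda>x\<in>\<V>. c)} = {\<omega> \<in> space M. fixates_to_constant V \<V> \<zeta> \<omega>}"
    by (intro Collect_cong conj_cong refl fixates_to_constant_iff[symmetric] right_cont \<zeta>_in_S)
  finally show ?thesis .
qed

lemma fixates_if_absorbed_constant:
  assumes wd: "well_driven \<omega>" and \<omega>: "\<omega> \<in> space M" and t: "0 \<le> t"
    and ab: "absorbing (\<zeta> t \<omega>)" and c: "c \<in> V" "\<And>x. x \<in> \<V> \<Longrightarrow> \<zeta> t \<omega> x = c"
  shows "fixates_to_constant V \<V> \<zeta> \<omega>"
proof -
  obtain n :: nat where n: "t \<le> real n" using real_arch_simple by blast
  have const: "\<zeta> t \<omega> = (\<lambda>x\<in>\<V>. c)"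
    using \<zeta>_in_S[OF t \<omega>] c(2) by (auto simp: PiE_iff extensional_def fun_eq_iff)
  have "\<forall>q::rat. real n \<le> of_rat q \<longrightarrow> \<zeta> (of_rat q) \<omega> = (\<lambda>x\<in>\<V>. c)"
    using absorbing_forever[OF wd \<omega> t _ ab] n const by (metis order_trans)
  then show ?thesis
    using fixates_to_constant_iff[of \<zeta> \<omega> \<V> V, OF right_cont[OF \<omega>] \<zeta>_in_S[OF _ \<omega>]] c(1) by blast
qed

end

section \<open>The lattice of opinions\<close>

definition l1_dist :: "int ^ 'n::finite \<Rightarrow> int ^ 'n \<Rightarrow> int" where
  "l1_dist a b = (\<Sum>i\<in>UNIV. \<bar>a $ i - b $ i\<bar>)"

definition move :: "int ^ 'n::finite \<Rightarrow> int ^ 'n \<Rightarrow> 'n \<Rightarrow> int ^ 'n" where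
  "move a b i = (\<chi> j. a $ j + (if j = i then sgn (b $ i - a $ i) else 0))"

lemma l1_dist_nonneg: "0 \<le> l1_dist a b"
  by (auto simp: l1_dist_def intro: sum_nonneg)

lemma l1_dist_commute: "l1_dist a b = l1_dist b a"
  by (simp add: l1_dist_def abs_minus_commute)

lemma l1_dist_triangle: "l1_dist a c \<le> l1_dist a b + l1_dist b c"
  unfolding l1_dist_def sum.distrib[symmetric] by (intro sum_mono) auto

lemma l1_dist_eq_0_iff: "l1_dist a b = 0 \<longleftrightarrow> a = b"
  by (auto simp: l1_dist_def sum_nonneg_eq_0_iff vec_eq_iff)

lemma l1_dist_self [simp]: "l1_dist a a = 0"
  by (simp add: l1_dist_eq_0_iff)

text \<open>For integers |x| is at most x^2, with equality if |x| is at most 1, so a sum of squares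
  is 1 exactly when the sum of absolute values is.\<close>

lemma l1_dist_eq_1_iff: "l1_dist a b = 1 \<longleftrightarrow> dist (euclid a) (euclid b) = 1"
proof -
  let ?d = "\<lambda>i. a $ i - b $ i"
  have "dist (euclid a) (euclid b) = sqrt (\<Sum>i\<in>UNIV. (real_of_int (?d i))\<^sup>2)"
    by (simp add: dist_vec_def L2_set_def euclid_def dist_real_def)
  also have "(\<Sum>i\<in>UNIV. (real_of_int (?d i))\<^sup>2) = real_of_int (\<Sum>i\<in>UNIV. (?d i)\<^sup>2)" by simp
  finally have 1: "dist (euclid a) (euclid b) = 1 \<longleftrightarrow> (\<Sum>i\<in>UNIV. (?d i)\<^sup>2) = 1"
    by (metis of_int_eq_1_iff real_sqrt_eq_1_iff)
  have le: "\<bar>x\<bar> \<le> x\<^sup>2" for x :: int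
  proof (cases "x = 0")
    case False
    then have "\<bar>x\<bar> * 1 \<le> \<bar>x\<bar> * \<bar>x\<bar>" by (intro mult_left_mono) auto
    then show ?thesis by (simp add: power2_eq_square)
  qed simp
  have "(\<Sum>i\<in>UNIV. (?d i)\<^sup>2) = 1 \<longleftrightarrow> l1_dist a b = 1"
  proof
    assume sq: "(\<Sum>i\<in>UNIV. (?d i)\<^sup>2) = 1"
    have "l1_dist a b \<le> (\<Sum>i\<in>UNIV. (?d i)\<^sup>2)"
      unfolding l1_dist_def by (intro sum_mono le)
    moreover have "l1_dist a b \<noteq> 0" using sq by (auto simp: l1_dist_eq_0_iff)
    ultimately show "l1_dist a b = 1" using sq l1_dist_nonneg[of a b] by linarith
  next
    assume l: "l1_dist a b = 1"
    have "(?d i)\<^sup>2 = \<bar>?d i\<bar>" for i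
    proof -
      have "\<bar>?d i\<bar> \<le> 1" unfolding l[symmetric] l1_dist_def by (rule member_le_sum) auto
      then have "?d i = 0 \<or> ?d i = 1 \<or> ?d i = -1" by linarith
      then show ?thesis by auto
    qed
    then show "(\<Sum>i\<in>UNIV. (?d i)\<^sup>2) = 1" using l by (simp add: l1_dist_def)
  qed
  with 1 show ?thesis by simp
qed

lemma dir_edges_lattice:
  "(a, b) \<in> dir_edges (lattice_edges L) \<longleftrightarrow>
     a \<in> lattice_vertices L \<and> b \<in> lattice_vertices L \<and> l1_dist a b = 1"
  unfolding dir_edges_def lattice_edges_def
  by (auto simp: doubleton_eq_iff l1_dist_eq_1_iff dist_commute)

lemma move_in_lattice:
  assumes "a \<in> lattice_vertices L" "b \<in> lattice_vertices L"
  shows "move a b i \<in> lattice_vertices L"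
  unfolding lattice_vertices_def
proof (intro CollectI allI)
  fix j
  have "- int (L j) \<le> a $ j" "a $ j \<le> int (L j)" "- int (L j) \<le> b $ j" "b $ j \<le> int (L j)"
    using assms by (auto simp: lattice_vertices_def)
  then show "- int (L j) \<le> move a b i $ j \<and> move a b i $ j \<le> int (L j)"
    by (auto simp: move_def sgn_if)
qed

text \<open>Assuming the shift as an equation lets the same computation serve \<open>move\<close>,
  through \<open>move_def\<close>, and the vectors from \<open>unit_shift\<close>.\<close>

lemma l1_dist_shift:
  assumes "a' = (\<chi> j. a $ j + (if j = i then s else 0))"
  shows "l1_dist a' b = l1_dist a b + (\<bar>a $ i + s - b $ i\<bar> - \<bar>a $ i - b $ i\<bar>)"
proof -
  have "l1_dist a' b = (\<Sum>j\<in>UNIV. \<bar>a $ j - b $ j\<bar> +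
      (if j = i then \<bar>a $ i + s - b $ i\<bar> - \<bar>a $ i - b $ i\<bar> else 0))"
    unfolding l1_dist_def assms by (intro sum.cong) auto
  then show ?thesis by (simp add: sum.distrib l1_dist_def)
qed

lemma l1_dist_move:
  assumes "a $ i \<noteq> b $ i"
  shows "l1_dist (move a b i) b = l1_dist a b - 1" and "l1_dist a (move a b i) = 1"
proof -
  show "l1_dist (move a b i) b = l1_dist a b - 1"
    unfolding l1_dist_shift[OF move_def] using assms by (auto simp: sgn_if)
  show "l1_dist a (move a b i) = 1"
    using assms l1_dist_shift[OF move_def, of a b i a] l1_dist_commute[of a "move a b i"]
    by (auto simp: sgn_if)
qed

lemma lattice_walk_length:
  "(a, b) \<in> dir_edges (lattice_edges L) ^^ k \<Longrightarrow> l1_dist a b \<le> int k"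
proof (induction k arbitrary: b)
  case 0
  then show ?case by simp
next
  case (Suc k)
  then obtain c where c: "(a, c) \<in> dir_edges (lattice_edges L) ^^ k" "(c, b) \<in> dir_edges (lattice_edges L)"
    by auto
  then show ?case using Suc.IH[OF c(1)] l1_dist_triangle[of a b c] by (simp add: dir_edges_lattice)
qed

lemma lattice_walk_exists:
  assumes "a \<in> lattice_vertices L" "b \<in> lattice_vertices L" "l1_dist a b = int k"
  shows "(a, b) \<in> dir_edges (lattice_edges L) ^^ k"
  using assms
proof (induction k arbitrary: a)
  case 0
  then show ?case by (simp add: l1_dist_eq_0_iff)
next
  case (Suc k)
  then have "a \<noteq> b" using l1_dist_eq_0_iff[of a b] by auto
  then obtain i where i: "a $ i \<noteq> b $ i" by (auto simp: vec_eq_iff)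
  have m: "move a b i \<in> lattice_vertices L" using Suc by (intro move_in_lattice)
  then have "(move a b i, b) \<in> dir_edges (lattice_edges L) ^^ k"
    using Suc l1_dist_move(1)[OF i] by (intro Suc.IH) auto
  moreover have "(a, move a b i) \<in> dir_edges (lattice_edges L)"
    using Suc m l1_dist_move(2)[OF i] by (simp add: dir_edges_lattice)
  ultimately show ?case by (rule relpow_Suc_I2[rotated])
qed

text \<open>No walk is shorter, since each edge changes the l1 distance by at most one; repeated use
  of \<open>move\<close> yields a walk of exactly that length, which never leaves the box.\<close>

lemma geo_dist_lattice:
  assumes "a \<in> lattice_vertices L" "b \<in> lattice_vertices L"
  shows "geo_dist (lattice_edges L) a b = enat (nat (l1_dist a b))"
  unfolding geo_dist_def
proof (rule antisym)
  have "(a, b) \<in> dir_edges (lattice_edges L) ^^ nat (l1_dist a b)"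
    using assms l1_dist_nonneg[of a b] by (intro lattice_walk_exists) auto
  then show "Inf {enat k |k. (a, b) \<in> dir_edges (lattice_edges L) ^^ k} \<le> enat (nat (l1_dist a b))"
    by (intro Inf_lower) auto
  show "enat (nat (l1_dist a b)) \<le> Inf {enat k |k. (a, b) \<in> dir_edges (lattice_edges L) ^^ k}"
    using lattice_walk_length by (intro Inf_greatest) fastforce
qed

lemma compatible_lattice:
  assumes "a \<in> lattice_vertices L" "b \<in> lattice_vertices L"
  shows "compatible (lattice_edges L) \<tau> a b \<longleftrightarrow> a \<noteq> b \<and> l1_dist a b \<le> int \<tau>"
  using l1_dist_nonneg[of a b] l1_dist_eq_0_iff[of a b]
  by (auto simp: compatible_def geo_dist_lattice[OF assms] zero_enat_def)

lemma unit_shift: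
  assumes "l1_dist a a' = 1"
  obtains i s where "\<bar>s\<bar> = 1" "a' = (\<chi> j. a $ j + (if j = i then s else 0))"
proof -
  have "a \<noteq> a'" using assms l1_dist_eq_0_iff[of a a'] by auto
  then obtain i where i: "a $ i \<noteq> a' $ i" by (auto simp: vec_eq_iff)
  have "l1_dist a a' = \<bar>a $ i - a' $ i\<bar> + (\<Sum>j\<in>UNIV - {i}. \<bar>a $ j - a' $ j\<bar>)"
    unfolding l1_dist_def by (rule sum.remove) auto
  moreover have "0 \<le> (\<Sum>j\<in>UNIV - {i}. \<bar>a $ j - a' $ j\<bar>)" by (intro sum_nonneg) auto
  moreover have "1 \<le> \<bar>a $ i - a' $ i\<bar>" using i by linarith
  ultimately have 1: "\<bar>a $ i - a' $ i\<bar> = 1" and "(\<Sum>j\<in>UNIV - {i}. \<bar>a $ j - a' $ j\<bar>) = 0"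
    using assms by linarith+
  then have "\<forall>j\<in>UNIV - {i}. \<bar>a $ j - a' $ j\<bar> = 0" by (subst (asm) sum_nonneg_eq_0_iff) auto
  then have "a' = (\<chi> j. a $ j + (if j = i then a' $ i - a $ i else 0))"
    by (auto simp: vec_eq_iff)
  moreover have "\<bar>a' $ i - a $ i\<bar> = 1" using 1 by linarith
  ultimately show thesis using that by blast
qed

text \<open>A neighbour of \<open>a\<close> shifts one coordinate by +1 or -1, and the distance to
  \<open>b\<close> drops only if that coordinate differs from that of \<open>b\<close> and the shift
  is towards it.\<close>

lemma closer_nbrs_lattice:
  assumes a: "a \<in> lattice_vertices L" and b: "b \<in> lattice_vertices L"
  shows "closer_nbrs (lattice_vertices L) (lattice_edges L) a b = move a b ` {i. a $ i \<noteq> b $ i}"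
proof (intro equalityI subsetI)
  fix a' assume "a' \<in> closer_nbrs (lattice_vertices L) (lattice_edges L) a b"
  then have a': "a' \<in> lattice_vertices L"
    and g: "geo_dist (lattice_edges L) a a' = 1"
      "geo_dist (lattice_edges L) a' b = geo_dist (lattice_edges L) a b - 1"
    by (auto simp: closer_nbrs_def)
  have 1: "l1_dist a a' = 1"
    using g(1) l1_dist_nonneg[of a a'] by (simp add: geo_dist_lattice[OF a a'] one_enat_def)
  then obtain i s where s: "\<bar>s\<bar> = 1" and a'_eq: "a' = (\<chi> j. a $ j + (if j = i then s else 0))"
    by (rule unit_shift)
  have "nat (l1_dist a' b) = nat (l1_dist a b) - 1"
    using g(2) by (simp add: geo_dist_lattice[OF a' b] geo_dist_lattice[OF a b] one_enat_def)
  moreover have sh: "l1_dist a' b = l1_dist a b + (\<bar>a $ i + s - b $ i\<bar> - \<bar>a $ i - b $ i\<bar>)"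
    by (rule l1_dist_shift[OF a'_eq])
  \<comment> \<open>The subtraction of 1 truncates at 0, so the case \<open>a = b\<close> has to be
    excluded: there \<open>a'\<close> would be at distance 0 from \<open>b = a\<close>, against
    \<open>l1_dist a a' = 1\<close>.\<close>
  moreover have "l1_dist a b \<noteq> 0"
  proof
    assume "l1_dist a b = 0"
    then have "a = b" by (simp add: l1_dist_eq_0_iff)
    with \<open>nat (l1_dist a' b) = nat (l1_dist a b) - 1\<close> 1 show False
      by (simp add: l1_dist_commute[of a'])
  qed
  ultimately have "\<bar>a $ i + s - b $ i\<bar> - \<bar>a $ i - b $ i\<bar> = -1"
    using l1_dist_nonneg[of a b] l1_dist_nonneg[of a' b] by linarith
  then have "a $ i \<noteq> b $ i" "s = sgn (b $ i - a $ i)" using s by (auto simp: sgn_if)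
  then show "a' \<in> move a b ` {i. a $ i \<noteq> b $ i}" by (auto simp: a'_eq move_def)
next
  fix a' assume "a' \<in> move a b ` {i. a $ i \<noteq> b $ i}"
  then obtain i where i: "a $ i \<noteq> b $ i" "a' = move a b i" by blast
  have a': "a' \<in> lattice_vertices L" using i a b by (simp add: move_in_lattice)
  show "a' \<in> closer_nbrs (lattice_vertices L) (lattice_edges L) a b"
    using l1_dist_move[OF i(1)] a' l1_dist_nonneg[of a' b]
    by (auto simp: closer_nbrs_def geo_dist_lattice[OF a a'] geo_dist_lattice[OF a' b]
        geo_dist_lattice[OF a b] i(2)[symmetric] one_enat_def nat_diff_distrib)
qed

text \<open>Makes a uniform choice from D(a, b) a uniform choice among the coordinates in which
  \<open>a\<close> and \<open>b\<close> differ.\<close>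

lemma inj_on_move: "inj_on (move a b) {i. a $ i \<noteq> b $ i}"
proof (rule inj_onI, rule ccontr)
  fix i j assume "i \<in> {i. a $ i \<noteq> b $ i}" "move a b i = move a b j" "i \<noteq> j"
  then have "move a b i $ i = move a b j $ i" "a $ i \<noteq> b $ i" by auto
  then show False using \<open>i \<noteq> j\<close> by (simp add: move_def sgn_if split: if_splits)
qed

section \<open>Averages over the lattice\<close>

lemma lattice_vertices_PiE:
  "bij_betw vec_lambda (PiE UNIV (\<lambda>i. {- int (L i)..int (L i)})) (lattice_vertices L)"
proof (rule bij_betw_byWitness[where f' = vec_nth])
qed (auto simp: lattice_vertices_def PiE_iff)

lemma finite_lattice_vertices: "finite (lattice_vertices L)"
  using bij_betw_finite[OF lattice_vertices_PiE[of L]] by (simp add: finite_PiE)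

lemma sum_abs_symmetric_interval: "(\<Sum>y\<in>{- int l..int l}. \<bar>y\<bar>) = int l * (int l + 1)"
proof (induction l)
  case (Suc l)
  have "{- int (Suc l)..int (Suc l)} = insert (- int (Suc l)) (insert (int (Suc l)) {- int l..int l})"
    by auto
  then have "(\<Sum>y\<in>{- int (Suc l)..int (Suc l)}. \<bar>y\<bar>) = 2 * int (Suc l) + (\<Sum>y\<in>{- int l..int l}. \<bar>y\<bar>)"
    by simp
  then show ?case unfolding Suc by (simp add: algebra_simps)
qed simp

lemma sum_abs_coordinate_lattice:
  fixes L :: "'n::finite \<Rightarrow> nat"
  shows "(\<Sum>v\<in>lattice_vertices L. real_of_int \<bar>v $ i\<bar>) =
    real (card (lattice_vertices L)) * (real (L i) * (real (L i) + 1) / (2 * real (L i) + 1))"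
proof -
  let ?B = "\<lambda>i. {- int (L i)..int (L i)}"
  \<comment> \<open>The lattice is a product of intervals, so sums of product functions factor. The
    factor |y| at coordinate \<open>i\<close> and 1 elsewhere isolates that coordinate.\<close>
  have sum: "(\<Sum>v\<in>lattice_vertices L. \<Prod>j\<in>UNIV. f j (v $ j)) = (\<Prod>j\<in>UNIV. \<Sum>y\<in>?B j. f j y)"
    for f :: "'n \<Rightarrow> int \<Rightarrow> real"
    using sum.reindex_bij_betw[OF lattice_vertices_PiE[of L], of "\<lambda>v. \<Prod>j\<in>UNIV. f j (v $ j)"]
      prod_sum_PiE[of UNIV ?B f] by simp
  have card: "real (card (lattice_vertices L)) = (\<Prod>j\<in>UNIV. 2 * real (L j) + 1)"
    using sum[of "\<lambda>_ _. 1"] by (simp add: algebra_simps)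
  have "(\<Sum>v\<in>lattice_vertices L. real_of_int \<bar>v $ i\<bar>) =
      (\<Sum>v\<in>lattice_vertices L. \<Prod>j\<in>UNIV. if j = i then real_of_int \<bar>v $ j\<bar> else 1)"
    by (intro sum.cong refl) (simp add: prod.delta)
  also have "\<dots> = (\<Prod>j\<in>UNIV. \<Sum>y\<in>?B j. if j = i then real_of_int \<bar>y\<bar> else 1)"
    by (rule sum)
  also have "\<dots> = (\<Prod>j\<in>UNIV. (2 * real (L j) + 1) *
      (if j = i then real (L i) * (real (L i) + 1) / (2 * real (L i) + 1) else 1))"
  proof (intro prod.cong refl)
    fix j
    have "(\<Sum>y\<in>?B i. real_of_int \<bar>y\<bar>) = real_of_int (\<Sum>y\<in>?B i. \<bar>y\<bar>)" by simp
    also have "\<dots> = real (L i) * (real (L i) + 1)" unfolding sum_abs_symmetric_interval by simp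
    finally have "(\<Sum>y\<in>?B i. real_of_int \<bar>y\<bar>) = real (L i) * (real (L i) + 1)" .
    moreover have "2 * real (L i) + 1 \<noteq> 0" by linarith
    ultimately show "(\<Sum>y\<in>?B j. if j = i then real_of_int \<bar>y\<bar> else 1) = (2 * real (L j) + 1) *
      (if j = i then real (L i) * (real (L i) + 1) / (2 * real (L i) + 1) else 1)"
      by (cases "j = i") simp_all
  qed
  also have "\<dots> = real (card (lattice_vertices L)) * (real (L i) * (real (L i) + 1) / (2 * real (L i) + 1))"
    unfolding card prod.distrib by (simp add: prod.delta)
  finally show ?thesis .
qed

section \<open>Attraction process on the lattice\<close>

locale lattice_attraction = attraction_graphical M "lattice_vertices L" "lattice_edges L" \<V> \<E> \<tau> \<zeta> N C
  for M :: "'w measure" and L :: "'n::finite \<Rightarrow> nat" and \<V> :: "'v set" and \<E> \<tau> \<zeta> N C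
begin

definition drift :: "(('v \<Rightarrow> int ^ 'n) \<Rightarrow> real) \<Rightarrow> ('v \<Rightarrow> int ^ 'n) \<Rightarrow> 'v \<times> 'v \<Rightarrow> 'n \<Rightarrow> real" where
  "drift f \<eta> e i = f (\<eta>(fst e := move (\<eta> (fst e)) (\<eta> (snd e)) i)) - f \<eta>"

abbreviation differing :: "('v \<Rightarrow> int ^ 'n) \<Rightarrow> 'v \<times> 'v \<Rightarrow> 'n set" where
  "differing \<eta> e \<equiv> {i. \<eta> (fst e) $ i \<noteq> \<eta> (snd e) $ i}"

abbreviation compat :: "('v \<Rightarrow> int ^ 'n) \<Rightarrow> 'v \<times> 'v \<Rightarrow> bool" where
  "compat \<eta> e \<equiv> compatible (lattice_edges L) \<tau> (\<eta> (fst e)) (\<eta> (snd e))"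

lemma sum_nbrs_lattice:
  assumes "\<eta> \<in> S" "e \<in> D" "compat \<eta> e"
  shows "(\<Sum>v\<in>nbrs \<eta> e. (f (\<eta>(fst e := v)) - f \<eta>) / card (nbrs \<eta> e)) =
    (\<Sum>i\<in>differing \<eta> e. drift f \<eta> e i) / card (differing \<eta> e)"
proof -
  have "nbrs \<eta> e = move (\<eta> (fst e)) (\<eta> (snd e)) ` differing \<eta> e"
    using assms edge_opinions[OF assms(2,1)] by (simp add: nbrs_def closer_nbrs_lattice)
  then show ?thesis
    by (simp add: sum.reindex[OF inj_on_move] card_image[OF inj_on_move] drift_def sum_divide_distrib)
qed

text \<open>The two orientations of an edge are equally likely to ring, so their drifts can be added.\<close>

lemma gen_lattice:
  assumes \<eta>: "\<eta> \<in> S"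
  shows "gen f \<eta> = (\<Sum>e\<in>D. if compat \<eta> e
    then (\<Sum>i\<in>differing \<eta> e. drift f \<eta> e i + drift f \<eta> (prod.swap e) i) / (2 * card (differing \<eta> e)) else 0)"
proof -
  define g where "g e = (\<Sum>v\<in>nbrs \<eta> e. (f (\<eta>(fst e := v)) - f \<eta>) / card (nbrs \<eta> e))" for e
  have swapD: "prod.swap e \<in> D" if "e \<in> D" for e
    using dir_edges_mem(4)[OF sg, of "fst e" "snd e"] that by (simp add: prod.swap_def)
  have "bij_betw prod.swap D D"
    by (rule bij_betw_byWitness[where f' = prod.swap]) (auto dest: swapD)
  then have "(\<Sum>e\<in>D. g (prod.swap e)) = (\<Sum>e\<in>D. g e)" by (rule sum.reindex_bij_betw)
  moreover have "gen f \<eta> = (\<Sum>e\<in>D. g e)" by (simp only: gen_def g_def)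
  \<comment> \<open>Replacing each term by its average with the reversed edge leaves the sum over
    \<open>D\<close> unchanged; this is the source of the 2 in the denominator.\<close>
  ultimately have "gen f \<eta> = (\<Sum>e\<in>D. (g e + g (prod.swap e)) / 2)"
    by (simp add: sum.distrib sum_divide_distrib[symmetric])
  also have "\<dots> = (\<Sum>e\<in>D. if compat \<eta> e
    then (\<Sum>i\<in>differing \<eta> e. drift f \<eta> e i + drift f \<eta> (prod.swap e) i) / (2 * card (differing \<eta> e)) else 0)"
  proof (intro sum.cong refl)
    fix e assume e: "e \<in> D"
    have V: "\<eta> (fst e) \<in> lattice_vertices L" "\<eta> (snd e) \<in> lattice_vertices L"
      using edge_opinions[OF e \<eta>] by auto
    have sym: "compat \<eta> (prod.swap e) \<longleftrightarrow> compat \<eta> e"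
      using V by (auto simp: compatible_lattice l1_dist_commute)
    \<comment> \<open>Reversing an edge keeps the differing coordinates, hence the weight of each of
      them, so the two drifts pair up coordinate by coordinate.\<close>
    have dif: "differing \<eta> (prod.swap e) = differing \<eta> e" by auto
    show "(g e + g (prod.swap e)) / 2 = (if compat \<eta> e
      then (\<Sum>i\<in>differing \<eta> e. drift f \<eta> e i + drift f \<eta> (prod.swap e) i) / (2 * card (differing \<eta> e)) else 0)"
    proof (cases "compat \<eta> e")
      case True
      then have "g e = (\<Sum>i\<in>differing \<eta> e. drift f \<eta> e i) / card (differing \<eta> e)"
        "g (prod.swap e) = (\<Sum>i\<in>differing \<eta> e. drift f \<eta> (prod.swap e) i) / card (differing \<eta> e)"
        using sum_nbrs_lattice[OF \<eta> e] sum_nbrs_lattice[OF \<eta> swapD[OF e]] sym dif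
        unfolding g_def by simp_all
      then show ?thesis using True by (simp add: sum.distrib add_divide_distrib)
    next
      case False
      then have "nbrs \<eta> e = {}" "nbrs \<eta> (prod.swap e) = {}" using sym by (auto simp: nbrs_def)
      then show ?thesis using False by (simp add: g_def)
    qed
  qed
  finally show ?thesis .
qed

section \<open>The two functionals and their drifts\<close>

definition dist_center :: "('v \<Rightarrow> int ^ 'n) \<Rightarrow> real" where
  "dist_center \<eta> = (\<Sum>x\<in>\<V>. real_of_int (l1_dist (\<eta> x) 0))"

definition spread :: "('v \<Rightarrow> int ^ 'n) \<Rightarrow> real" where
  "spread \<eta> = (\<Sum>i\<in>UNIV. (\<Sum>x\<in>\<V>. real_of_int (\<eta> x $ i))\<^sup>2)"

lemma sum_fun_upd:
  fixes g :: "'o \<Rightarrow> real"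
  assumes "x \<in> \<V>"
  shows "(\<Sum>y\<in>\<V>. g ((\<eta>(x := w)) y)) = (\<Sum>y\<in>\<V>. g (\<eta> y)) + (g w - g (\<eta> x))"
proof -
  have "(\<Sum>y\<in>\<V>. g ((\<eta>(x := w)) y)) = (\<Sum>y\<in>\<V>. g (\<eta> y) + (if y = x then g w - g (\<eta> x) else 0))"
    by (intro sum.cong) auto
  then show ?thesis using assms fin\<V> by (simp add: sum.distrib)
qed

text \<open>Convexity of the absolute value: for integers p < q, |p + 1| + |q - 1| is at most |p| +
  |q|; for q = p + 1 the two values are merely exchanged.\<close>

lemma drift_dist_center:
  assumes e: "e \<in> D" and i: "i \<in> differing \<eta> e"
  shows "drift dist_center \<eta> e i + drift dist_center \<eta> (prod.swap e) i \<le> 0"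
proof -
  have m: "fst e \<in> \<V>" "snd e \<in> \<V>" using dir_edges_mem[OF sg, of "fst e" "snd e"] e by simp_all
  have upd: "dist_center (\<eta>(x := w)) - dist_center \<eta> =
      real_of_int (l1_dist w 0) - real_of_int (l1_dist (\<eta> x) 0)" if "x \<in> \<V>" for x w
    unfolding dist_center_def sum_fun_upd[OF that, of "\<lambda>v. real_of_int (l1_dist v 0)"] by simp
  let ?a = "\<eta> (fst e)" and ?b = "\<eta> (snd e)"
  have "\<bar>?a $ i + sgn (?b $ i - ?a $ i)\<bar> - \<bar>?a $ i\<bar> + (\<bar>?b $ i + sgn (?a $ i - ?b $ i)\<bar> - \<bar>?b $ i\<bar>) \<le> 0"
    using i by (auto simp: sgn_if)
  then show ?thesis
    unfolding drift_def using upd m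
    by (simp add: l1_dist_shift[OF move_def])
qed

lemma gen_dist_center:
  assumes "\<eta> \<in> S"
  shows "gen dist_center \<eta> \<le> 0"
  unfolding gen_lattice[OF assms]
  by (intro sum_nonpos) (auto intro!: divide_nonpos_nonneg sum_nonpos drift_dist_center)

text \<open>According to which endpoint moves, the total \<open>X i\<close> changes by s or by -s,
  with s^2 = 1. The cross terms 2 s X i and -2 s X i cancel and the two squares remain.\<close>

lemma drift_spread:
  assumes e: "e \<in> D" and i: "i \<in> differing \<eta> e"
  shows "drift spread \<eta> e i + drift spread \<eta> (prod.swap e) i = 2"
proof -
  have m: "fst e \<in> \<V>" "snd e \<in> \<V>" using dir_edges_mem[OF sg, of "fst e" "snd e"] e by simp_all
  define X where "X j = (\<Sum>x\<in>\<V>. real_of_int (\<eta> x $ j))" for j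
  have upd: "spread (\<eta>(x := move (\<eta> x) b i)) - spread \<eta> =
      2 * real_of_int (sgn (b $ i - \<eta> x $ i)) * X i + (real_of_int (sgn (b $ i - \<eta> x $ i)))\<^sup>2"
    if "x \<in> \<V>" for x b
  proof -
    let ?s = "real_of_int (sgn (b $ i - \<eta> x $ i))"
    have "spread (\<eta>(x := move (\<eta> x) b i)) = (\<Sum>j\<in>UNIV. (X j + (if j = i then ?s else 0))\<^sup>2)"
      unfolding spread_def X_def
    proof (intro sum.cong refl arg_cong[of _ _ "\<lambda>z. z\<^sup>2"])
      fix j
      show "(\<Sum>y\<in>\<V>. real_of_int ((\<eta>(x := move (\<eta> x) b i)) y $ j)) =
          (\<Sum>y\<in>\<V>. real_of_int (\<eta> y $ j)) + (if j = i then ?s else 0)"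
        using sum_fun_upd[OF that, of "\<lambda>v. real_of_int (v $ j)" \<eta> "move (\<eta> x) b i"]
        by (simp add: move_def)
    qed
    also have "\<dots> = (\<Sum>j\<in>UNIV. (X j)\<^sup>2 + (if j = i then 2 * ?s * X i + ?s\<^sup>2 else 0))"
      by (intro sum.cong refl) (auto simp: power2_eq_square algebra_simps)
    also have "\<dots> = spread \<eta> + (2 * ?s * X i + ?s\<^sup>2)"
      by (simp add: sum.distrib spread_def X_def)
    finally show ?thesis by simp
  qed
  show ?thesis
    using i upd[OF m(1), of "\<eta> (snd e)"] upd[OF m(2), of "\<eta> (fst e)"]
    by (auto simp: drift_def sgn_if)
qed

text \<open>Each differing coordinate contributes 2 and the denominator is twice their number, so a
  compatible edge counts 1 however many coordinates differ.\<close>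

lemma gen_spread:
  assumes \<eta>: "\<eta> \<in> S"
  shows "gen spread \<eta> = real (card {e \<in> D. compat \<eta> e})"
proof -
  have "gen spread \<eta> = (\<Sum>e\<in>D. if compat \<eta> e then 1 else 0)"
    unfolding gen_lattice[OF \<eta>]
  proof (intro sum.cong if_cong refl)
    fix e assume e: "e \<in> D" "compat \<eta> e"
    then have "differing \<eta> e \<noteq> {}"
      using edge_opinions[OF e(1) \<eta>] by (auto simp: compatible_lattice vec_eq_iff)
    then have "0 < real (card (differing \<eta> e))" by (simp only: of_nat_0_less_iff card_gt_0_iff finite) simp
    then have ne: "real (2 * card (differing \<eta> e)) \<noteq> 0"
      unfolding of_nat_mult of_nat_numeral by linarith
    have sum: "(\<Sum>i\<in>differing \<eta> e. drift spread \<eta> e i + drift spread \<eta> (prod.swap e) i) =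
        2 * card (differing \<eta> e)"
      using drift_spread[OF e(1)] by simp
    show "(\<Sum>i\<in>differing \<eta> e. drift spread \<eta> e i + drift spread \<eta> (prod.swap e) i) /
        (2 * card (differing \<eta> e)) = 1"
      unfolding sum using ne by (rule divide_self)
  qed
  also have "\<dots> = real (card {e \<in> D. compat \<eta> e})"
    using finD by (simp add: sum.If_cases Int_def)
  finally show ?thesis .
qed

lemma prob_not_absorbing_lattice:
  obtains B where "\<And>t. 0 < t \<Longrightarrow> t * prob {\<omega> \<in> space M. \<not> absorbing (\<zeta> t \<omega>)} \<le> B"
proof
  fix t :: real assume t: "0 < t"
  have nonneg: "0 \<le> spread \<eta>" for \<eta> by (auto simp: spread_def intro!: sum_nonneg)
  \<comment> \<open>Any bound that does not depend on \<open>t\<close> will do, since it is later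
    divided by \<open>t\<close>.\<close>
  show "t * prob {\<omega> \<in> space M. \<not> absorbing (\<zeta> t \<omega>)} \<le> (\<Sum>\<eta>\<in>S. spread \<eta>)"
  proof (rule prob_not_absorbing[OF t, of spread])
    fix \<eta> assume \<eta>: "\<eta> \<in> S"
    show "0 \<le> spread \<eta>" by (rule nonneg)
    show "spread \<eta> \<le> (\<Sum>\<eta>\<in>S. spread \<eta>)" using \<eta> finS nonneg by (intro member_le_sum) auto
    show "(if absorbing \<eta> then 0 else 1) \<le> gen spread \<eta>"
    proof (cases "absorbing \<eta>")
      case False
      then have "{e \<in> D. compat \<eta> e} \<noteq> {}" by (auto simp: absorbing_def)
      then have "card {e \<in> D. compat \<eta> e} > 0" using finD by (auto simp: card_gt_0_iff)
      then show ?thesis using False gen_spread[OF \<eta>] by simp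
    qed (simp add: gen_spread[OF \<eta>])
  qed
qed

section \<open>Absence of consensus and the final estimate\<close>

lemma opinion_far_if_stuck:
  assumes conn: "connected_graph \<V> \<E>" and \<eta>: "\<eta> \<in> S" and ab: "absorbing \<eta>"
    and x: "x \<in> \<V>" and z: "z \<in> \<V>" "\<eta> z \<noteq> \<eta> x"
  shows "int \<tau> + 1 - (\<Sum>i\<in>UNIV. int (L i)) \<le> l1_dist (\<eta> x) 0"
proof -
  \<comment> \<open>A walk from \<open>x\<close> to \<open>z\<close> must cross an edge from a
    vertex with the opinion of \<open>x\<close> to one with another opinion.\<close>
  have "\<exists>u v. (u, v) \<in> D \<and> \<eta> u = \<eta> x \<and> \<eta> v \<noteq> \<eta> x"
  proof (rule ccontr)
    assume no: "\<not> ?thesis"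
    have "(x, z) \<in> D\<^sup>*" using conn x z(1) by (simp add: connected_graph_def)
    then have "\<eta> z = \<eta> x"
    proof induction
      case (step y z)
      then show ?case using no by blast
    qed simp
    with z show False by simp
  qed
  then obtain u v where uv: "(u, v) \<in> D" "\<eta> u = \<eta> x" "\<eta> v \<noteq> \<eta> x" by blast
  have V: "\<eta> u \<in> lattice_vertices L" "\<eta> v \<in> lattice_vertices L"
    using edge_opinions[OF uv(1) \<eta>] by auto
  have "\<not> compatible (lattice_edges L) \<tau> (\<eta> u) (\<eta> v)" using ab uv(1) by (auto simp: absorbing_def)
  \<comment> \<open>The distance is an integer, so exceeding \<open>\<tau>\<close> gives
    \<open>\<tau> + 1\<close>; the other endpoint contributes at most the radius.\<close>
  then have "int \<tau> < l1_dist (\<eta> u) (\<eta> v)" using V uv by (auto simp: compatible_lattice)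
  also have "\<dots> \<le> l1_dist (\<eta> u) 0 + l1_dist 0 (\<eta> v)" by (rule l1_dist_triangle)
  also have "l1_dist 0 (\<eta> v) \<le> (\<Sum>i\<in>UNIV. int (L i))"
    unfolding l1_dist_def
  proof (rule sum_mono)
    fix i
    have "- int (L i) \<le> \<eta> v $ i" "\<eta> v $ i \<le> int (L i)" using V(2) by (auto simp: lattice_vertices_def)
    then show "\<bar>0 $ i - \<eta> v $ i\<bar> \<le> int (L i)" by simp
  qed
  finally show ?thesis using uv by simp
qed

lemma expectation_dist_center_initial:
  assumes "uniform_product_initial (lattice_vertices L) \<V> \<zeta>"
  shows "expectation (\<lambda>\<omega>. dist_center (\<zeta> 0 \<omega>)) =
    real (card \<V>) * (\<Sum>i\<in>UNIV. real (L i) * (real (L i) + 1) / (2 * real (L i) + 1))"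
proof -
  let ?V = "lattice_vertices L" and ?g = "\<lambda>v. real_of_int (l1_dist v 0)"
  have "0 \<in> ?V" by (simp add: lattice_vertices_def)
  then have card: "card ?V > 0" using finV by (auto simp: card_gt_0_iff)
  have one: "integrable M (\<lambda>\<omega>. ?g (\<zeta> 0 \<omega> x)) \<and> expectation (\<lambda>\<omega>. ?g (\<zeta> 0 \<omega> x)) =
      (\<Sum>i\<in>UNIV. real (L i) * (real (L i) + 1) / (2 * real (L i) + 1))" if x: "x \<in> \<V>" for x
  proof -
    have rv: "(\<lambda>\<omega>. \<zeta> 0 \<omega> x) \<in> M \<rightarrow>\<^sub>M count_space ?V"
      and di: "distr M (count_space ?V) (\<lambda>\<omega>. \<zeta> 0 \<omega> x) = uniform_count_measure ?V"
      using assms x by (auto simp: uniform_product_initial_def indep_vars_def)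
    have pr: "prob {\<omega> \<in> space M. \<zeta> 0 \<omega> x = v} = 1 / card ?V" if "v \<in> ?V" for v
    proof -
      have "measure (distr M (count_space ?V) (\<lambda>\<omega>. \<zeta> 0 \<omega> x)) {v} =
          prob ((\<lambda>\<omega>. \<zeta> 0 \<omega> x) -` {v} \<inter> space M)"
        using rv that by (subst measure_distr) auto
      also have "(\<lambda>\<omega>. \<zeta> 0 \<omega> x) -` {v} \<inter> space M = {\<omega> \<in> space M. \<zeta> 0 \<omega> x = v}" by auto
      finally show ?thesis
        unfolding di using that finV by (simp add: measure_uniform_count_measure)
    qed
    have inV: "\<And>\<omega>. \<omega> \<in> space M \<Longrightarrow> \<zeta> 0 \<omega> x \<in> ?V" using measurable_space[OF rv] by simp
    have int: "integrable M (\<lambda>\<omega>. ?g (\<zeta> 0 \<omega> x))"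
      by (rule expectation_finite_valued(1)[OF finV inV pred_eq_count_space[OF rv]])
    have "expectation (\<lambda>\<omega>. ?g (\<zeta> 0 \<omega> x)) = (\<Sum>v\<in>?V. (1 / card ?V) * ?g v)"
      by (subst expectation_finite_valued(2)[where X = "\<lambda>\<omega>. \<zeta> 0 \<omega> x", OF finV inV pred_eq_count_space[OF rv]])
         (auto intro!: sum.cong simp: pr)
    also have "\<dots> = (1 / card ?V) * (\<Sum>v\<in>?V. \<Sum>i\<in>UNIV. real_of_int \<bar>v $ i\<bar>)"
      by (simp add: sum_distrib_left l1_dist_def)
    \<comment> \<open>Exchanging the sums leaves the mean of each coordinate's absolute value, which
      is the term for \<open>L i\<close>.\<close>
    also have "\<dots> = (1 / card ?V) * (\<Sum>i\<in>UNIV. \<Sum>v\<in>?V. real_of_int \<bar>v $ i\<bar>)"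
      by (subst sum.swap) simp
    also have "\<dots> = (\<Sum>i\<in>UNIV. real (L i) * (real (L i) + 1) / (2 * real (L i) + 1))"
      unfolding sum_abs_coordinate_lattice sum_distrib_left[symmetric] using card by simp
    finally show ?thesis using int by simp
  qed
  have "expectation (\<lambda>\<omega>. dist_center (\<zeta> 0 \<omega>)) = (\<Sum>x\<in>\<V>. expectation (\<lambda>\<omega>. ?g (\<zeta> 0 \<omega> x)))"
    unfolding dist_center_def using one by (intro Bochner_Integration.integral_sum) auto
  then show ?thesis using one by simp
qed

lemma pred_\<zeta>_property: "0 \<le> t \<Longrightarrow> {\<omega> \<in> space M. P (\<zeta> t \<omega>)} \<in> events"
proof -
  assume t: "0 \<le> t"
  have "{\<omega> \<in> space M. P (\<zeta> t \<omega>)} = (\<Union>\<eta>\<in>{\<eta> \<in> S. P \<eta>}. {\<omega> \<in> space M. \<zeta> t \<omega> = \<eta>})"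
    using \<zeta>_in_S[OF t] by blast
  also have "\<dots> \<in> events"
    using finS pred_\<zeta>[OF t] by (intro sets.finite_UN) (simp_all add: pred_def)
  finally show ?thesis .
qed

lemma prob_stuck:
  assumes conn: "connected_graph \<V> \<E>"
    and r: "(\<Sum>i\<in>UNIV. L i) \<le> \<tau>"
    and init: "uniform_product_initial (lattice_vertices L) \<V> \<zeta>" and t: "0 < t"
  shows "prob {\<omega> \<in> space M. absorbing (\<zeta> t \<omega>) \<and> (\<exists>x\<in>\<V>. \<exists>y\<in>\<V>. \<zeta> t \<omega> x \<noteq> \<zeta> t \<omega> y)} \<le>
    (1 / (real \<tau> + 1 - real (\<Sum>i\<in>UNIV. L i))) *
    (\<Sum>i\<in>UNIV. real (L i) * (real (L i) + 1) / (2 * real (L i) + 1))"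
proof -
  define A where "A = {\<omega> \<in> space M. absorbing (\<zeta> t \<omega>) \<and> (\<exists>x\<in>\<V>. \<exists>y\<in>\<V>. \<zeta> t \<omega> x \<noteq> \<zeta> t \<omega> y)}"
  define k where "k = real \<tau> + 1 - real (\<Sum>i\<in>UNIV. L i)"
  have "real (\<Sum>i\<in>UNIV. L i) \<le> real \<tau>" using r by (simp only: of_nat_le_iff)
  then have k: "k > 0" unfolding k_def by linarith
  have t0: "0 \<le> t" using t by simp
  have Aev: "A \<in> events" unfolding A_def by (rule pred_\<zeta>_property[OF t0])
  have card: "real (card \<V>) > 0" using conn fin\<V> by (simp add: connected_graph_def card_gt_0_iff)
  \<comment> \<open>Markov's inequality by hand: on \<open>A\<close> every vertex is at distance at
    least \<open>k\<close> from the centre, so \<open>dist_center\<close> is at least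
    \<open>card \<V> * k\<close>.\<close>
  have "card \<V> * k * prob A = expectation (\<lambda>\<omega>. card \<V> * k * indicator A \<omega>)" using Aev by simp
  also have "\<dots> \<le> expectation (\<lambda>\<omega>. dist_center (\<zeta> t \<omega>))"
  proof (rule integral_mono)
    show "integrable M (\<lambda>\<omega>. card \<V> * k * indicator A \<omega>)"
      using Aev by (intro integrable_mult_right integrable_real_indicator) (auto simp: emeasure_eq_measure)
    show "integrable M (\<lambda>\<omega>. dist_center (\<zeta> t \<omega>))"
      by (rule expectation_finite_valued(1)[OF finS \<zeta>_in_S[OF t0] pred_\<zeta>[OF t0]])
    fix \<omega> assume \<omega>: "\<omega> \<in> space M"
    show "card \<V> * k * indicator A \<omega> \<le> dist_center (\<zeta> t \<omega>)"
    proof (cases "\<omega> \<in> A")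
      case True
      then obtain x y where xy: "absorbing (\<zeta> t \<omega>)" "x \<in> \<V>" "y \<in> \<V>" "\<zeta> t \<omega> x \<noteq> \<zeta> t \<omega> y"
        by (auto simp: A_def)
      have "k \<le> real_of_int (l1_dist (\<zeta> t \<omega> u) 0)" if u: "u \<in> \<V>" for u
      proof -
        \<comment> \<open>Two vertices disagree, so at least one of them disagrees with
          \<open>u\<close>.\<close>
        obtain z where z: "z \<in> \<V>" "\<zeta> t \<omega> z \<noteq> \<zeta> t \<omega> u"
          using xy by (cases "\<zeta> t \<omega> x = \<zeta> t \<omega> u") auto
        have "int \<tau> + 1 - (\<Sum>i\<in>UNIV. int (L i)) \<le> l1_dist (\<zeta> t \<omega> u) 0"
          by (rule opinion_far_if_stuck[OF conn \<zeta>_in_S[OF t0 \<omega>] xy(1) u z])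
        then have "real_of_int (int \<tau> + 1 - (\<Sum>i\<in>UNIV. int (L i))) \<le> real_of_int (l1_dist (\<zeta> t \<omega> u) 0)"
          by (simp only: of_int_le_iff)
        then show ?thesis by (simp add: k_def)
      qed
      then have "(\<Sum>u\<in>\<V>. k) \<le> dist_center (\<zeta> t \<omega>)" unfolding dist_center_def by (rule sum_mono)
      then show ?thesis using True by simp
    next
      case False
      then show ?thesis by (auto simp: dist_center_def intro!: sum_nonneg l1_dist_nonneg)
    qed
  qed
  also have "\<dots> \<le> expectation (\<lambda>\<omega>. dist_center (\<zeta> 0 \<omega>))"
    by (rule expectation_nonincreasing[OF t gen_dist_center])
  also have "\<dots> = card \<V> * (\<Sum>i\<in>UNIV. real (L i) * (real (L i) + 1) / (2 * real (L i) + 1))"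
    by (rule expectation_dist_center_initial[OF init])
  finally have "k * prob A \<le> (\<Sum>i\<in>UNIV. real (L i) * (real (L i) + 1) / (2 * real (L i) + 1))"
    using card by (simp add: mult.assoc)
  then show ?thesis using k unfolding A_def[symmetric] k_def[symmetric] by (simp add: field_simps)
qed

theorem prob_consensus:
  assumes conn: "connected_graph \<V> \<E>"
    and r: "(\<Sum>i\<in>UNIV. L i) \<le> \<tau>"
    and init: "uniform_product_initial (lattice_vertices L) \<V> \<zeta>"
  shows "1 - (1 / (real \<tau> + 1 - real (\<Sum>i\<in>UNIV. L i))) *
      (\<Sum>i\<in>UNIV. real (L i) * (real (L i) + 1) / (2 * real (L i) + 1)) \<le>
    prob {\<omega> \<in> space M. fixates_to_constant (lattice_vertices L) \<V> \<zeta> \<omega>}"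
    (is "1 - ?Q \<le> prob ?F")
proof -
  obtain B where B: "\<And>t. 0 < t \<Longrightarrow> t * prob {\<omega> \<in> space M. \<not> absorbing (\<zeta> t \<omega>)} \<le> B"
    using prob_not_absorbing_lattice by blast
  obtain x0 where x0: "x0 \<in> \<V>" using conn by (auto simp: connected_graph_def)
  have "1 - ?Q \<le> prob ?F + B / real n" if n: "0 < n" for n
  proof -
    let ?t = "real n"
    have t: "0 < ?t" "0 \<le> ?t" using n by simp_all
    let ?U = "{\<omega> \<in> space M. \<not> absorbing (\<zeta> ?t \<omega>)}"
      and ?A = "{\<omega> \<in> space M. absorbing (\<zeta> ?t \<omega>) \<and> (\<exists>x\<in>\<V>. \<exists>y\<in>\<V>. \<zeta> ?t \<omega> x \<noteq> \<zeta> ?t \<omega> y)}"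
    have ev: "?U \<in> events" "?A \<in> events"
      using pred_\<zeta>_property[OF t(2)] by simp_all
    \<comment> \<open>Up to a null set, a path absorbed at time \<open>n\<close> without
      disagreement has reached consensus for good. Failure of absorption costs at most
      \<open>B / n\<close>, which disappears in the limit.\<close>
    have "prob (space M) \<le> prob (?F \<union> (?U \<union> ?A))"
    proof (rule finite_measure_mono_AE)
      show "AE \<omega> in M. \<omega> \<in> space M \<longrightarrow> \<omega> \<in> ?F \<union> (?U \<union> ?A)"
        using AE_well_driven
      proof eventually_elim
        case (elim \<omega>)
        show ?case
        proof (intro impI, rule ccontr)
          assume \<omega>: "\<omega> \<in> space M" and no: "\<omega> \<notin> ?F \<union> (?U \<union> ?A)"
          then have ab: "absorbing (\<zeta> ?t \<omega>)" by blast
          with \<omega> no x0 have c: "\<zeta> ?t \<omega> x = \<zeta> ?t \<omega> x0" if "x \<in> \<V>" for x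
            using that by blast
          have "\<zeta> ?t \<omega> x0 \<in> lattice_vertices L" using \<zeta>_in_S[OF t(2) \<omega>] x0 by auto
          then have "fixates_to_constant (lattice_vertices L) \<V> \<zeta> \<omega>"
            by (rule fixates_if_absorbed_constant[OF elim \<omega> t(2) ab _ c])
          then show False using no \<omega> by simp
        qed
      qed
    qed (use ev fixates_event in blast)
    also have "\<dots> \<le> prob ?F + prob (?U \<union> ?A)"
      using ev fixates_event by (intro measure_Un_le sets.Un)
    also have "prob (?U \<union> ?A) \<le> prob ?U + prob ?A"
      using ev by (intro measure_Un_le)
    also have "prob ?U \<le> B / real n" using B[OF t(1)] t(1) by (simp add: field_simps)
    also have "prob ?A \<le> ?Q" by (rule prob_stuck[OF conn r init t(1)])
    finally show ?thesis by (simp add: prob_space)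
  qed
  moreover have "(\<lambda>n. prob ?F + B / real n) \<longlonglongrightarrow> prob ?F + 0"
    by (intro tendsto_intros tendsto_divide_0[OF tendsto_const] filterlim_at_top_imp_at_infinity
        filterlim_real_sequentially)
  ultimately have "1 - ?Q \<le> prob ?F + 0"
    by (intro LIMSEQ_le_const[of "\<lambda>n. prob ?F + B / real n"]) (auto intro!: exI[of _ 1])
  then show ?thesis by simp
qed

end

theorem theorem4:
  fixes M :: "'w measure"
    and L :: "'n::finite \<Rightarrow> nat"
    and \<V> :: "'v set" and \<E> :: "'v set set"
    and r \<tau> :: nat
    and \<zeta> :: "real \<Rightarrow> 'w \<Rightarrow> 'v \<Rightarrow> int ^ 'n"
  assumes "prob_space M"
    and "\<And>i. 1 \<le> L i"
    and "r = (\<Sum>i\<in>UNIV. L i)"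
    and "simple_graph \<V> \<E>" and "finite \<V>" and "connected_graph \<V> \<E>"
    and "r \<le> \<tau>" and "\<tau> < 2 * r"
    and "prob_space.attraction_process M (lattice_vertices L) (lattice_edges L) \<V> \<E> \<tau> \<zeta>"
    and "prob_space.uniform_product_initial M (lattice_vertices L) \<V> \<zeta>"
  shows "measure M {\<omega> \<in> space M. fixates_to_constant (lattice_vertices L) \<V> \<zeta> \<omega>}
    \<ge> 1 - (1 / (real \<tau> + 1 - real r)) *
          (\<Sum>i\<in>UNIV. real (L i) * (real (L i) + 1) / (2 * real (L i) + 1))"
proof -
  interpret prob_space M by fact
  note ap = assms(9)[unfolded attraction_process_def]
  from ap obtain N C where NC: "attraction_graphical M (lattice_vertices L) (lattice_edges L) \<V> \<E> \<tau> \<zeta> N C"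
    unfolding attraction_graphical_def attraction_graphical_axioms_def
    using finite_lattice_vertices[of L] assms(4,5) prob_space_axioms by blast
  interpret attraction_graphical M "lattice_vertices L" "lattice_edges L" \<V> \<E> \<tau> \<zeta> N C by (rule NC)
  interpret lattice_attraction M L \<V> \<E> \<tau> \<zeta> N C ..
  show ?thesis
    using prob_consensus assms(3,6,7,10) by simp
qed

end
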